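(* Let $q \geq 5$ be a prime power, let $\mathbb{F}_q$ be the finite field of order $q$, and let $x$ be a primitive element of $\mathbb{F}_q$. Consider the elements of $\mathrm{PSL}(3,q)$ represented by the matrices $$\sigma_1 = \begin{pmatrix} x & 1 & 0 \\ 0 & 1 + x^{-1} & -x^{-1} \\ 0 & 1 & 0 \end{pmatrix},\quad \sigma_2 = \begin{pmatrix} -x^{-1} & 0 & 0 \\ 0 & 0 & 1 \\ 0 & x & 0 \end{pmatrix},\quad \sigma_3 = \begin{pmatrix} x & 0 & 0 \\ x - x^{-1} & 1 & 0 \\ x - x^{-1} & 0 & x^{-1} \end{pmatrix}.$$ Then $(\mathrm{PSL}(3,q),(\sigma_1,\sigma_2,\sigma_3))$ gives a chiral polytope of rank four. Moreover, $\langle \sigma_1, \sigma_2\rangle$ is the (setwise) stabiliser in $\mathrm{PSL}(3,q)$ of a set of two lines of the projective plane $\mathrm{PG}(2,q)$, while $\langle \sigma_2,\sigma_3\rangle$ is the (setwise) stabiliser in $\mathrm{PSL}(3,q)$ of a set of two points of $\mathrm{PG}(2,q)$. Finally, this polytope is self-dual of Schläfli type $\{q-1, \frac{2(q-1)}{(3,q-1)}, q-1\}$.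
   Context: A matrix of determinant $1$ denotes its class in $\mathrm{PSL}(3,q)$, which acts naturally on the points and lines of $\mathrm{PG}(2,q)$ (points are given by homogeneous column vectors). $(3,q-1)$ denotes the greatest common divisor. A primitive element of $\mathbb{F}_q$ is a generator of its multiplicative group. Chiral polytopes are described through groups. Let $G$ be a group, $r\ge 3$, and $(\sigma_1,\dots,\sigma_{r-1})$ a tuple of elements of $G$. For $1\le i\le j\le r-1$ put $\tau_{i,j}=\sigma_i\sigma_{i+1}\cdots\sigma_j$ (so $\tau_{i,i}=\sigma_i$). The pair $(G,(\sigma_1,\dots,\sigma_{r-1}))$ gives a chiral polytope of rank $r$ with automorphism group $G$ if the $\sigma_i$ generate $G$ and: (1) (string property) $\tau_{i,j}$ is an involution (element of order exactly $2$) whenever $1\le i<j\le r-1$; (2) (intersection property) for all $I,J\subseteq\{0,\dots,r-1\}$, $\langle \tau_{i,j} \mid i\le j,\ i-1,j\notin I\rangle\cap\langle \tau_{i,j}\mid i\le j,\ i-1,j\notin J\rangle=\langle \tau_{i,j}\mid i\le j,\ i-1,j\notin I\cup J\rangle$; (3) (chirality) there is no automorphism of $G$ sending $\sigma_1$ to $\sigma_1^{-1}$ and fixing $\tau_{1,i}$ for all $i=2,\dots,r-1$. A group is the automorphism group of a chiral polytope of rank $r$ if and only if such a tuple exists. The Schläfli type is the tuple of the orders of $\sigma_1,\dots,\sigma_{r-1}$. The dual of the polytope given by $(\sigma_1,\dots,\sigma_{r-1})$ is the one given by $(\sigma_{r-1}^{-1},\dots,\sigma_1^{-1})$ in the same group.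 The polytope is self-dual if it is isomorphic to its dual; for rank four this means that some automorphism of $G$ maps $(\sigma_1,\sigma_2,\sigma_3)$ to $(\sigma_3^{-1},\sigma_2^{-1},\sigma_1^{-1})$ or to the tuple $(\sigma_3,\sigma_3^{-2}\sigma_2^{-1},\sigma_1^{-1})$ that gives the dual polytope with respect to an adjacent base flag. *)

theory Defs
  imports "HOL-Analysis.Analysis" "HOL-Algebra.Algebra" "HOL-Number_Theory.Prime_Powers"
begin

definition primitive_element :: "'a::field \<Rightarrow> bool" where
  "primitive_element x \<longleftrightarrow> range (\<lambda>k::int. x powi k) = UNIV - {0}"


section \<open>\<open>PSL\<close> and its action on projective space\<close>

definition SL :: "('a::field^'n::finite^'n) monoid" where
  "SL = \<lparr>carrier = {A. det A = 1}, monoid.mult = (**), one = mat 1\<rparr>"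

definition SL_scalars :: "('a::field^'n::finite^'n) set" where
  "SL_scalars = {A \<in> carrier SL. \<exists>c. A = mat c}"

definition PSL :: "('a::field^'n::finite^'n) set monoid" where
  "PSL = SL Mod SL_scalars"

definition PSL_class :: "'a::field^'n::finite^'n \<Rightarrow> ('a^'n^'n) set" where
  "PSL_class A = SL_scalars #>\<^bsub>SL\<^esub> A"

text \<open>Points and lines of the projective space are the subspaces of dimension 1 and 2 of the space
  of column vectors.\<close>

definition proj_points :: "('a::field^'n::finite) set set" where
  "proj_points = {U. vec.subspace U \<and> vec.dim U = 1}"

definition proj_lines :: "('a::field^'n::finite) set set" where
  "proj_lines = {U. vec.subspace U \<and> vec.dim U = 2}"

text \<open>All representatives of a class map a subspace \<open>U\<close> to the same subspace, so the union below is
  the image of \<open>U\<close> under any one of them.\<close>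

definition PSL_act :: "('a::field^'n::finite^'n) set \<Rightarrow> ('a^'n) set \<Rightarrow> ('a^'n) set" where
  "PSL_act C U = (\<Union>A\<in>C. (*v) A ` U)"

definition PSL_setwise_stabiliser ::
  "('a::field^'n::finite) set set \<Rightarrow> ('a^'n^'n) set set" where
  "PSL_setwise_stabiliser S = {C \<in> carrier PSL. PSL_act C ` S = S}"


section \<open>Chiral polytopes as groups with distinguished generators\<close>

text \<open>A tuple \<open>(\<sigma>\<^sub>1, \<dots>, \<sigma>\<^sub>r\<^sub>-\<^sub>1)\<close> is a list of length \<open>r - 1\<close>, so that \<open>\<sigma>\<^sub>k\<close> is
  \<open>\<sigma> ! (k - 1)\<close>, and \<open>tau G \<sigma> i j\<close> is \<open>\<sigma>\<^sub>i \<otimes> \<dots> \<otimes> \<sigma>\<^sub>j\<close>.\<close>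

definition tau :: "('g, 'm) monoid_scheme \<Rightarrow> 'g list \<Rightarrow> nat \<Rightarrow> nat \<Rightarrow> 'g" where
  "tau G \<sigma> i j = foldr (\<otimes>\<^bsub>G\<^esub>) (map (\<lambda>k. \<sigma> ! (k - 1)) [i..<Suc j]) \<one>\<^bsub>G\<^esub>"

definition tau_subgroup ::
  "('g, 'm) monoid_scheme \<Rightarrow> nat \<Rightarrow> 'g list \<Rightarrow> nat set \<Rightarrow> 'g set" where
  "tau_subgroup G r \<sigma> I =
     generate G {tau G \<sigma> i j |i j. 1 \<le> i \<and> i \<le> j \<and> j \<le> r - 1 \<and> i - 1 \<notin> I \<and> j \<notin> I}"

definition string_property :: "('g, 'm) monoid_scheme \<Rightarrow> nat \<Rightarrow> 'g list \<Rightarrow> bool" where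
  "string_property G r \<sigma> \<longleftrightarrow>
     (\<forall>i j. 1 \<le> i \<and> i < j \<and> j \<le> r - 1 \<longrightarrow> group.ord G (tau G \<sigma> i j) = 2)"

definition intersection_property :: "('g, 'm) monoid_scheme \<Rightarrow> nat \<Rightarrow> 'g list \<Rightarrow> bool" where
  "intersection_property G r \<sigma> \<longleftrightarrow>
     (\<forall>I J. I \<subseteq> {0..r - 1} \<and> J \<subseteq> {0..r - 1} \<longrightarrow>
        tau_subgroup G r \<sigma> I \<inter> tau_subgroup G r \<sigma> J = tau_subgroup G r \<sigma> (I \<union> J))"

definition chirality_property :: "('g, 'm) monoid_scheme \<Rightarrow> nat \<Rightarrow> 'g list \<Rightarrow> bool" where
  "chirality_property G r \<sigma> \<longleftrightarrow>
     \<not> (\<exists>\<phi> \<in> iso G G. \<phi> (tau G \<sigma> 1 1) = inv\<^bsub>G\<^esub> (tau G \<sigma> 1 1) \<and>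
            (\<forall>i \<in> {2..r - 1}. \<phi> (tau G \<sigma> 1 i) = tau G \<sigma> 1 i))"

definition gives_chiral_polytope :: "('g, 'm) monoid_scheme \<Rightarrow> nat \<Rightarrow> 'g list \<Rightarrow> bool" where
  "gives_chiral_polytope G r \<sigma> \<longleftrightarrow>
     group G \<and> 3 \<le> r \<and> length \<sigma> = r - 1 \<and> set \<sigma> \<subseteq> carrier G \<and>
     generate G (set \<sigma>) = carrier G \<and>
     string_property G r \<sigma> \<and> intersection_property G r \<sigma> \<and> chirality_property G r \<sigma>"

definition schlaefli_type :: "('g, 'm) monoid_scheme \<Rightarrow> 'g list \<Rightarrow> nat list" where
  "schlaefli_type G \<sigma> = map (group.ord G) \<sigma>"

text \<open>The two disjuncts correspond to the dual polytope with respect to the dual base flag and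
  with respect to a flag adjacent to it.\<close>

definition self_dual_rank4 :: "('g, 'm) monoid_scheme \<Rightarrow> 'g \<Rightarrow> 'g \<Rightarrow> 'g \<Rightarrow> bool" where
  "self_dual_rank4 G \<sigma>\<^sub>1 \<sigma>\<^sub>2 \<sigma>\<^sub>3 \<longleftrightarrow>
     (\<exists>\<phi> \<in> iso G G.
        (\<phi> \<sigma>\<^sub>1 = inv\<^bsub>G\<^esub> \<sigma>\<^sub>3 \<and> \<phi> \<sigma>\<^sub>2 = inv\<^bsub>G\<^esub> \<sigma>\<^sub>2 \<and> \<phi> \<sigma>\<^sub>3 = inv\<^bsub>G\<^esub> \<sigma>\<^sub>1) \<or>
        (\<phi> \<sigma>\<^sub>1 = \<sigma>\<^sub>3 \<and> \<phi> \<sigma>\<^sub>2 = (\<sigma>\<^sub>3 [^]\<^bsub>G\<^esub> (-2::int)) \<otimes>\<^bsub>G\<^esub> inv\<^bsub>G\<^esub> \<sigma>\<^sub>2 \<and>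
         \<phi> \<sigma>\<^sub>3 = inv\<^bsub>G\<^esub> \<sigma>\<^sub>1))"

end

theory Submission
  imports Defs
begin

text \<open>Everything is computed with matrices, through the homomorphism from \<open>SL\<close> to \<open>PSL\<close>. The group
  \<open>\<langle>\<sigma>\<^sub>2, \<sigma>\<^sub>3\<rangle>\<close> lies in the stabiliser of \<open>{\<langle>e\<^sub>2\<rangle>, \<langle>e\<^sub>3\<rangle>}\<close>, an extension of the elementary abelian
  group \<open>N\<close> of elations with axis \<open>\<langle>e\<^sub>2, e\<^sub>3\<rangle>\<close> by a monomial group. It covers the monomial quotient, and it
  contains a nontrivial commutator in \<open>N\<close>, from which the torus produces all of \<open>N\<close> because
  \<open>x\<^sup>3 \<noteq> 1\<close>. A polarity (inverse transpose followed by conjugation with a symmetric matrix) inverts and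
  exchanges \<open>\<sigma>\<^sub>1\<close> and \<open>\<sigma>\<^sub>3\<close> and inverts \<open>\<sigma>\<^sub>2\<close>; it gives self-duality and turns all this into
  the statement on \<open>\<langle>\<sigma>\<^sub>1, \<sigma>\<^sub>2\<rangle>\<close> and two lines. The elations in both subgroups generate \<open>SL\<close>.

  For chirality, dualise the forbidden automorphism: it then inverts \<open>\<sigma>\<^sub>3\<close> and preserves \<open>\<langle>\<sigma>\<^sub>2, \<sigma>\<^sub>3\<rangle>\<close>,
  and it maps a one-dimensional eigenspace of \<open>\<sigma>\<^sub>3\<close> in \<open>N\<close>, whose elements are iterated commutators with
  \<open>\<sigma>\<^sub>3\<close>, into \<open>N\<close>. On \<open>N\<close> the element \<open>\<sigma>\<^sub>3\<close> has eigenvalues \<open>x\<^sup>-\<^sup>1\<close> and \<open>x\<^sup>-\<^sup>2\<close>, so one of the maps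
  \<open>y \<mapsto> y\<^sup>-\<^sup>1\<close>, \<open>y \<mapsto> y\<^sup>-\<^sup>2\<close> would be additive, which forces \<open>x\<^sup>3 = 1\<close>.\<close>


section \<open>Matrices of size three\<close>

text \<open>A nine-argument form on which the simplifier can compute: products, determinants,
  transposes and equalities of matrices reduce to equations between field elements.\<close>

definition mat3 :: "'a \<Rightarrow> 'a \<Rightarrow> 'a \<Rightarrow> 'a \<Rightarrow> 'a \<Rightarrow> 'a \<Rightarrow> 'a \<Rightarrow> 'a \<Rightarrow> 'a \<Rightarrow> 'a::field^3^3" where
  "mat3 a b c d e f g h i = vector [vector [a, b, c], vector [d, e, f], vector [g, h, i]]"

lemma mat3_nth [simp]:
  "mat3 a b c d e f g h i $ 1 $ 1 = a" "mat3 a b c d e f g h i $ 1 $ 2 = b"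
  "mat3 a b c d e f g h i $ 1 $ 3 = c" "mat3 a b c d e f g h i $ 2 $ 1 = d"
  "mat3 a b c d e f g h i $ 2 $ 2 = e" "mat3 a b c d e f g h i $ 2 $ 3 = f"
  "mat3 a b c d e f g h i $ 3 $ 1 = g" "mat3 a b c d e f g h i $ 3 $ 2 = h"
  "mat3 a b c d e f g h i $ 3 $ 3 = i"
  by (simp_all add: mat3_def)

lemma mat3_eq_iff [simp]:
  "mat3 a b c d e f g h i = mat3 a' b' c' d' e' f' g' h' i' \<longleftrightarrow>
    a = a' \<and> b = b' \<and> c = c' \<and> d = d' \<and> e = e' \<and> f = f' \<and> g = g' \<and> h = h' \<and> i = i'"
  by (metis mat3_nth)

lemma mat3_cases:
  fixes M :: "'a::field^3^3"
  obtains a b c d e f g h i where "M = mat3 a b c d e f g h i"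
proof
  show "M = mat3 (M$1$1) (M$1$2) (M$1$3) (M$2$1) (M$2$2) (M$2$3) (M$3$1) (M$3$2) (M$3$3)"
    by (simp add: vec_eq_iff forall_3)
qed

lemma mat3_mult [simp]:
  "mat3 a b c d e f g h i ** mat3 a' b' c' d' e' f' g' h' i' =
    mat3 (a * a' + b * d' + c * g') (a * b' + b * e' + c * h') (a * c' + b * f' + c * i')
         (d * a' + e * d' + f * g') (d * b' + e * e' + f * h') (d * c' + e * f' + f * i')
         (g * a' + h * d' + i * g') (g * b' + h * e' + i * h') (g * c' + h * f' + i * i')"
  by (simp add: vec_eq_iff forall_3 matrix_matrix_mult_def sum_3)

lemma det_mat3 [simp]:
  "det (mat3 a b c d e f g h i) = a*e*i + b*f*g + c*d*h - a*f*h - b*d*i - c*e*g"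
  by (simp add: det_3)

lemma mat_eq_mat3: "(mat k :: 'a::field^3^3) = mat3 k 0 0 0 k 0 0 0 k"
  by (simp add: vec_eq_iff forall_3 mat_def)

lemma transpose_mat3 [simp]: "transpose (mat3 a b c d e f g h i) = mat3 a d g b e h c f i"
  by (simp add: vec_eq_iff forall_3 transpose_def)

lemma vec3_cases:
  fixes v :: "'a::zero^3"
  obtains a b c where "v = vector [a, b, c]"
proof
  show "v = vector [v$1, v$2, v$3]"
    by (simp add: vec_eq_iff forall_3)
qed

lemma vector3_eq_iff [simp]:
  "(vector [a, b, c] :: 'a::zero^3) = vector [a', b', c'] \<longleftrightarrow> a = a' \<and> b = b' \<and> c = c'"
  by (metis vector_3)

lemma mat3_mult_vector [simp]:
  "mat3 a b c d e f g h i *v vector [r, s, t] =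
    vector [a * r + b * s + c * t, d * r + e * s + f * t, g * r + h * s + i * t]"
  by (simp add: vec_eq_iff forall_3 matrix_vector_mult_def sum_3)

lemma scale_vector3 [simp]:
  "k *s (vector [a, b, c] :: 'a::field^3) = vector [k * a, k * b, k * c]"
  by (simp add: vec_eq_iff forall_3)

lemma add_vector3 [simp]:
  "(vector [a, b, c] :: 'a::field^3) + vector [a', b', c'] = vector [a + a', b + b', c + c']"
  and diff_vector3 [simp]:
  "(vector [a, b, c] :: 'a::field^3) - vector [a', b', c'] = vector [a - a', b - b', c - c']"
  by (simp_all add: vec_eq_iff forall_3)


section \<open>The projective special linear group as a quotient\<close>

lemma carrier_SL: "M \<in> carrier SL \<longleftrightarrow> det M = 1"
  and mult_SL [simp]: "M \<otimes>\<^bsub>SL\<^esub> N = M ** N"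
  and one_SL [simp]: "\<one>\<^bsub>SL\<^esub> = mat 1"
  by (simp_all add: SL_def)

lemma group_SL: "group (SL :: ('a::field^'n::finite^'n) monoid)"
proof (rule groupI)
  fix M :: "'a^'n^'n" assume "M \<in> carrier SL"
  then have M: "det M = 1" by (simp add: carrier_SL)
  then obtain N where N: "N ** M = mat 1"
    using invertible_det_nz[of M] invertible_left_inverse by auto
  then have "det N * det M = 1"
    by (metis det_I det_mul)
  with M N show "\<exists>N\<in>carrier SL. N \<otimes>\<^bsub>SL\<^esub> M = \<one>\<^bsub>SL\<^esub>"
    by (auto simp: carrier_SL)
qed (auto simp: carrier_SL det_mul matrix_mul_assoc)

interpretation SL: group "SL :: ('a::field^'n::finite^'n) monoid"
  by (rule group_SL)

lemma SL_inv_right: "M \<in> carrier SL \<Longrightarrow> M ** inv\<^bsub>SL\<^esub> M = mat 1"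
  and SL_inv_left: "M \<in> carrier SL \<Longrightarrow> inv\<^bsub>SL\<^esub> M ** M = mat 1"
  using SL.r_inv[of M] SL.l_inv[of M] by simp_all

lemma SL_inv_eqI: "M ** N = mat 1 \<Longrightarrow> M \<in> carrier SL \<Longrightarrow> inv\<^bsub>SL\<^esub> M = N"
  by (metis SL_inv_left matrix_mul_assoc matrix_mul_lid matrix_mul_rid)

lemma mat_mult_nth: "(mat k ** M) $ i $ j = k * (M :: 'a::field^'n::finite^'n) $ i $ j"
proof -
  have "(if i = l then k else 0) * M $ l $ j = (if i = l then k * M $ l $ j else 0)" for l
    by simp
  then show ?thesis by (simp add: matrix_matrix_mult_def mat_def)
qed

lemma mult_mat_nth: "(M ** mat k) $ i $ j = (M :: 'a::field^'n::finite^'n) $ i $ j * k"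
proof -
  have "M $ i $ l * (if l = j then k else 0) = (if l = j then M $ i $ l * k else 0)" for l
    by simp
  then show ?thesis by (simp add: matrix_matrix_mult_def mat_def)
qed

lemma mat_mult_commute: "mat k ** M = (M :: 'a::field^'n::finite^'n) ** mat k"
  by (simp add: vec_eq_iff mat_mult_nth mult_mat_nth mult.commute)

lemma mat_mult_vector: "(mat k :: 'a::field^'n::finite^'n) *v v = k *s v"
proof -
  have "(if i = l then k else 0) * v $ l = (if i = l then k * v $ l else 0)" for i l
    by simp
  then show ?thesis by (simp add: vec_eq_iff matrix_vector_mult_def mat_def)
qed

lemma mat_mult_mat: "mat a ** (mat b :: 'a::field^'n::finite^'n) = mat (a * b)"
  by (simp add: vec_eq_iff mat_mult_nth) (simp add: mat_def)

lemma SL_scalars_iff: "M \<in> SL_scalars \<longleftrightarrow> M \<in> carrier SL \<and> (\<exists>k. M = mat k)"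
  by (simp add: SL_scalars_def)

lemma det_mat_nz: "det (mat k :: 'a::field^'n::finite^'n) \<noteq> 0 \<Longrightarrow> k \<noteq> 0"
  by (metis det_0 mat_0)

lemma subgroup_SL_scalars: "subgroup SL_scalars (SL :: ('a::field^'n::finite^'n) monoid)"
proof (rule SL.subgroupI)
  show "SL_scalars \<subseteq> carrier (SL :: ('a^'n^'n) monoid)"
    by (auto simp: SL_scalars_iff)
  show "(SL_scalars :: ('a^'n^'n) set) \<noteq> {}"
    using SL_scalars_iff[of "mat 1 :: 'a^'n^'n"] SL.one_closed by auto
next
  fix M N :: "'a^'n^'n" assume "M \<in> SL_scalars" "N \<in> SL_scalars"
  then show "M \<otimes>\<^bsub>SL\<^esub> N \<in> SL_scalars"
    using SL.m_closed[of M N] by (auto simp: SL_scalars_iff mat_mult_mat)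
next
  fix M :: "'a^'n^'n" assume M: "M \<in> SL_scalars"
  then obtain k where k: "M = mat k" and c: "M \<in> carrier SL" by (auto simp: SL_scalars_iff)
  then have "det (mat k :: 'a^'n^'n) \<noteq> 0" by (simp add: carrier_SL)
  then have "k \<noteq> 0" by (rule det_mat_nz)
  then have "M ** mat (inverse k) = mat 1" by (simp add: k mat_mult_mat)
  then have "inv\<^bsub>SL\<^esub> M = mat (inverse k)" using c by (rule SL_inv_eqI)
  then show "inv\<^bsub>SL\<^esub> M \<in> SL_scalars"
    using SL.inv_closed[OF c] by (auto simp: SL_scalars_iff)
qed

lemma normal_SL_scalars: "SL_scalars \<lhd> (SL :: ('a::field^'n::finite^'n) monoid)"
proof (rule SL.normal_invI[OF subgroup_SL_scalars])
  fix M N :: "'a^'n^'n" assume M: "M \<in> SL_scalars" and N: "N \<in> carrier SL"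
  from M obtain k where k: "M = mat k" by (auto simp: SL_scalars_iff)
  have "N ** M ** inv\<^bsub>SL\<^esub> N = M"
    by (metis N SL_inv_right k mat_mult_commute matrix_mul_assoc matrix_mul_rid)
  then show "N \<otimes>\<^bsub>SL\<^esub> M \<otimes>\<^bsub>SL\<^esub> inv\<^bsub>SL\<^esub> N \<in> SL_scalars"
    using M by simp
qed

interpretation SLZ: normal SL_scalars "SL :: ('a::field^'n::finite^'n) monoid"
  by (rule normal_SL_scalars)

lemma group_PSL: "group (PSL :: ('a::field^'n::finite^'n) set monoid)"
  unfolding PSL_def by (rule SLZ.factorgroup_is_group)

interpretation PSL: group "PSL :: ('a::field^'n::finite^'n) set monoid"
  by (rule group_PSL)

lemma PSL_class_hom: "PSL_class \<in> hom SL (PSL :: ('a::field^'n::finite^'n) set monoid)"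
  using SLZ.r_coset_hom_Mod unfolding PSL_def PSL_class_def .

interpretation PSL_class: group_hom SL "PSL :: ('a::field^'n::finite^'n) set monoid" PSL_class
  by (intro group_hom.intro group_SL group_PSL group_hom_axioms.intro PSL_class_hom)

lemma carrier_PSL: "carrier PSL = PSL_class ` carrier (SL :: ('a::field^'n::finite^'n) monoid)"
  by (auto simp: PSL_def PSL_class_def FactGroup_def RCOSETS_def)

lemma PSL_cases:
  assumes "U \<in> carrier PSL"
  obtains M where "M \<in> carrier SL" "U = PSL_class M"
  using assms by (auto simp: carrier_PSL)

lemma PSL_class_eq: "PSL_class (M :: 'a::field^'n::finite^'n) =
  {mat k ** M | k. (mat k :: 'a^'n^'n) \<in> carrier SL}"
  unfolding PSL_class_def r_coset_def SL_scalars_def by auto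

lemma PSL_class_eq_iff:
  fixes M N :: "'a::field^'n::finite^'n"
  assumes "M \<in> carrier SL" "N \<in> carrier SL"
  shows "PSL_class M = PSL_class N \<longleftrightarrow> (\<exists>k. (mat k :: 'a^'n^'n) \<in> carrier SL \<and> M = mat k ** N)"
proof
  assume "PSL_class M = PSL_class N"
  moreover have "M \<in> PSL_class M"
    unfolding PSL_class_def by (rule SL.rcos_self[OF assms(1) subgroup_SL_scalars])
  ultimately have "M \<in> PSL_class N" by simp
  then show "\<exists>k. (mat k :: 'a^'n^'n) \<in> carrier SL \<and> M = mat k ** N" unfolding PSL_class_eq by blast
next
  assume "\<exists>k. (mat k :: 'a^'n^'n) \<in> carrier SL \<and> M = mat k ** N"
  then have "M \<in> PSL_class N" unfolding PSL_class_eq by blast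
  then show "PSL_class M = PSL_class N"
    unfolding PSL_class_def by (metis SL.repr_independence assms(2) subgroup_SL_scalars)
qed

lemma PSL_class_eq_one_iff:
  assumes "M \<in> carrier SL"
  shows "PSL_class M = \<one>\<^bsub>PSL\<^esub> \<longleftrightarrow> (\<exists>k. M = mat k)"
proof -
  have "PSL_class M = \<one>\<^bsub>PSL\<^esub> \<longleftrightarrow> PSL_class M = PSL_class (mat 1)"
    by (metis PSL_class.hom_one one_SL)
  also have "\<dots> \<longleftrightarrow> (\<exists>k. M = mat k)"
    using assms SL.one_closed by (subst PSL_class_eq_iff) auto
  finally show ?thesis .
qed

section \<open>Computing in the quotient through representatives\<close>

lemma PSL_class_mult:
  "M \<in> carrier SL \<Longrightarrow> N \<in> carrier SL \<Longrightarrow> PSL_class M \<otimes>\<^bsub>PSL\<^esub> PSL_class N = PSL_class (M ** N)"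
  using PSL_class.hom_mult[of M N] by simp

text \<open>Two representatives differ by a scalar factor, which can be moved onto the vector and is
  absorbed by the subspace.\<close>

lemma PSL_act_class:
  assumes M: "M \<in> carrier SL" and U: "vec.subspace (U :: ('a::field^'n::finite) set)"
  shows "PSL_act (PSL_class M) U = (*v) M ` U"
proof
  show "PSL_act (PSL_class M) U \<subseteq> (*v) M ` U"
  proof
    fix w assume "w \<in> PSL_act (PSL_class M) U"
    then obtain N v where "N \<in> PSL_class M" "v \<in> U" "w = N *v v"
      by (auto simp: PSL_act_def)
    then obtain k v where v: "v \<in> U" "w = (mat k ** M) *v v"
      by (auto simp: PSL_class_eq)
    then have "w = M *v (k *s v)"
      by (metis mat_mult_commute mat_mult_vector matrix_vector_mul_assoc)
    then show "w \<in> (*v) M ` U" using v U vec.subspace_scale by blast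
  qed
  have "M \<in> PSL_class M"
    unfolding PSL_class_def by (rule SL.rcos_self[OF M subgroup_SL_scalars])
  then show "(*v) M ` U \<subseteq> PSL_act (PSL_class M) U" by (auto simp: PSL_act_def)
qed

lemma finite_SL: "finite (carrier (SL :: ('a::{field,finite}^'n::finite^'n) monoid))"
  by simp

lemma finite_PSL: "finite (carrier (PSL :: ('a::{field,finite}^'n::finite^'n) set monoid))"
  by (simp add: carrier_PSL)

lemma transpose_mult: "transpose (M ** N) = transpose N ** transpose (M :: 'a::field^'n::finite^'m::finite)"
  for N :: "'a::field^'k::finite^'n"
  by (simp add: vec_eq_iff transpose_def matrix_matrix_mult_def mult.commute)

text \<open>A subgroup containing the scalars is a union of cosets of the scalars, so its image
  determines it. Membership in a subgroup of \<open>PSL\<close> can therefore be tested on any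
  single matrix.\<close>

lemma PSL_class_mem_iff:
  fixes M :: "'a::field^'n::finite^'n"
  assumes M: "M \<in> carrier SL" and K: "subgroup K SL" and Z: "SL_scalars \<subseteq> K"
  shows "PSL_class M \<in> PSL_class ` K \<longleftrightarrow> M \<in> K"
proof
  assume "PSL_class M \<in> PSL_class ` K"
  then obtain N where N: "N \<in> K" "PSL_class M = PSL_class N" by auto
  moreover from N K have "N \<in> carrier SL" using subgroup.subset by blast
  ultimately obtain k where k: "(mat k :: 'a^'n^'n) \<in> carrier SL" "M = mat k ** N"
    using PSL_class_eq_iff[OF M] by metis
  then have "(mat k :: 'a^'n^'n) \<in> K" using Z SL_scalars_iff by blast
  then show "M \<in> K" using subgroup.m_closed[OF K _ N(1)] k(2) by simp
qed auto


section \<open>The intersection property in rank four\<close>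

lemma (in group) generate_inv_pair:
  assumes "a \<in> carrier G" "b \<in> carrier G"
  shows "generate G {inv a, inv b} = generate G {a, b}"
proof -
  have *: "generate G {inv a, inv b} \<subseteq> generate G {a, b}" if "a \<in> carrier G" "b \<in> carrier G" for a b
    using that by (intro generate_subgroup_incl generate_is_subgroup) (auto intro: generate.inv)
  from *[OF assms] *[of "inv a" "inv b"] assms show ?thesis by simp
qed

lemma (in group) ord_eq_twoI:
  assumes "a \<in> carrier G" "a \<otimes> a = \<one>" "a \<noteq> \<one>"
  shows "ord a = 2"
proof -
  have "a [^] (2::nat) = \<one>" using assms by (simp add: numeral_2_eq_2)
  then have "ord a dvd 2" using assms pow_eq_id by blast
  moreover have "ord a \<noteq> 1" using assms ord_eq_1 by blast
  ultimately show ?thesis using two_is_prime_nat prime_nat_iff by blast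
qed

text \<open>In a finite group the generated subgroup consists of natural powers of \<open>a\<close>,
  and the relation passes to powers by induction.\<close>

lemma (in group) inverting_generate:
  assumes fin: "finite (carrier G)" and c: "a \<in> carrier G" "w \<in> carrier G"
    and wa: "w \<otimes> a = inv a \<otimes> w" and y: "y \<in> generate G {a}"
  shows "w \<otimes> y = inv y \<otimes> w"
proof -
  from y obtain n :: nat where n: "y = a [^] n"
    using generate_pow_on_finite_carrier[OF fin c(1)] by auto
  have "w \<otimes> a [^] n = inv a [^] n \<otimes> w"
  proof (induction n)
    case (Suc n)
    have "w \<otimes> a [^] Suc n = inv a [^] n \<otimes> w \<otimes> a" using Suc c by (simp add: m_assoc[symmetric])
    also have "\<dots> = inv a [^] n \<otimes> (inv a \<otimes> w)" using c by (simp add: m_assoc wa)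
    finally show ?case using c by (simp add: m_assoc)
  qed (use c in simp)
  then show ?thesis using n c by (simp add: nat_pow_inv)
qed

text \<open>Conjugation by \<open>w\<close> inverts the cyclic subgroup \<open>?H\<close>, so the
  union of \<open>?H\<close> with its coset by \<open>w\<close> is already a subgroup. The two cases
  are the rotations and the reflections.\<close>

lemma (in group) generate_dihedral:
  assumes fin: "finite (carrier G)" and c: "a \<in> carrier G" "w \<in> carrier G"
    and ww: "w \<otimes> w = \<one>" and wa: "w \<otimes> a = inv a \<otimes> w"
    and v: "v \<in> generate G {a, w}"
  obtains "v \<in> generate G {a}" | y where "y \<in> generate G {a}" "v = y \<otimes> w"
proof -
  let ?H = "generate G {a}"
  have H: "subgroup ?H G" using c by (intro generate_is_subgroup) simp
  have Hc: "y \<in> carrier G" if "y \<in> ?H" for y using that subgroup.subset[OF H] by blast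
  note [simp] = Hc subgroup.m_closed[OF H] subgroup.m_inv_closed[OF H] subgroup.one_closed[OF H]
  have wy: "w \<otimes> y = inv y \<otimes> w" if "y \<in> ?H" for y
    by (rule inverting_generate[OF fin c wa that])
  let ?K = "?H \<union> (\<lambda>y. y \<otimes> w) ` ?H"
  have "subgroup ?K G"
  proof (rule subgroupI)
    fix k assume "k \<in> ?K"
    then consider "k \<in> ?H" | y where "y \<in> ?H" "k = y \<otimes> w" by auto
    then show "inv k \<in> ?K"
    proof cases
      case 2
      have "inv w = w" using c ww by (simp add: inv_equality)
      then have "inv k = y \<otimes> w" using 2 c wy[of "inv y"] by (simp add: inv_mult_group)
      then show ?thesis using 2 by auto
    qed simp
  next
    fix k l assume "k \<in> ?K" "l \<in> ?K"
    then consider "k \<in> ?H" "l \<in> ?H" | y where "y \<in> ?H" "k = y \<otimes> w" "l \<in> ?H"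
      | y where "k \<in> ?H" "y \<in> ?H" "l = y \<otimes> w"
      | y z where "y \<in> ?H" "k = y \<otimes> w" "z \<in> ?H" "l = z \<otimes> w" by auto
    then show "k \<otimes> l \<in> ?K"
    proof cases
      case 2
      have "k \<otimes> l = (y \<otimes> inv l) \<otimes> w" using 2 c wy[of l] by (simp add: m_assoc)
      then show ?thesis using 2 by auto
    next
      case 3
      have "k \<otimes> l = (k \<otimes> y) \<otimes> w" using 3 c by (simp add: m_assoc)
      then show ?thesis using 3 by auto
    next
      case 4
      have "k \<otimes> l = y \<otimes> (w \<otimes> z) \<otimes> w" using 4 c by (simp add: m_assoc)
      also have "\<dots> = y \<otimes> inv z" using 4 c ww wy[of z] by (simp add: m_assoc)
      finally show ?thesis using 4 by simp
    qed simp
  next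
    show "?K \<noteq> {}" using subgroup.one_closed[OF H] by blast
  qed (use c in auto)
  moreover have "w \<in> ?K" using c by (force intro: image_eqI[of _ _ \<one>])
  then have "{a, w} \<subseteq> ?K" by (auto intro: generate.incl)
  ultimately have "generate G {a, w} \<subseteq> ?K" by (rule generate_subgroup_incl[rotated])
  then show ?thesis using v that by auto
qed

section \<open>The distinguished subgroups in rank four and their intersections\<close>

lemma (in monoid) tau_rank4:
  assumes "a \<in> carrier G" "b \<in> carrier G" "c \<in> carrier G"
  shows "tau G [a, b, c] (Suc 0) (Suc 0) = a" "tau G [a, b, c] 2 2 = b" "tau G [a, b, c] 3 3 = c"
    "tau G [a, b, c] (Suc 0) 2 = a \<otimes> b" "tau G [a, b, c] 2 3 = b \<otimes> c" "tau G [a, b, c] (Suc 0) 3 = a \<otimes> (b \<otimes> c)"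
  using assms by (simp_all add: tau_def upt_rec)

text \<open>Rank four has only six index pairs. \<open>R\<close> and \<open>S\<close> stand for the
  conditions on \<open>i - 1\<close> and \<open>j\<close>, so a generating set becomes a union of
  conditional singletons.\<close>

lemma rank4_index_pairs:
  fixes f :: "nat \<Rightarrow> nat \<Rightarrow> 'b"
  shows "{f i j |i j. 1 \<le> i \<and> i \<le> j \<and> j \<le> 4 - 1 \<and> R i \<and> S j} =
    (if R (Suc 0) \<and> S (Suc 0) then {f (Suc 0) (Suc 0)} else {}) \<union> (if R 2 \<and> S 2 then {f 2 2} else {}) \<union>
    (if R 3 \<and> S 3 then {f 3 3} else {}) \<union> (if R (Suc 0) \<and> S 2 then {f (Suc 0) 2} else {}) \<union>
    (if R 2 \<and> S 3 then {f 2 3} else {}) \<union> (if R (Suc 0) \<and> S 3 then {f (Suc 0) 3} else {})"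
    (is "?A = ?B")
proof (intro equalityI subsetI)
  fix y assume "y \<in> ?A"
  then obtain i j where ij: "1 \<le> i" "i \<le> j" "j \<le> 4 - 1" "R i" "S j" and y: "y = f i j" by blast
  have "i = Suc 0 \<and> j = Suc 0 \<or> i = 2 \<and> j = 2 \<or> i = 3 \<and> j = 3 \<or> i = Suc 0 \<and> j = 2 \<or> i = 2 \<and> j = 3 \<or>
      i = Suc 0 \<and> j = 3"
    using ij(1-3) by linarith
  then show "y \<in> ?B" using ij(4,5) y by (elim disjE conjE) simp_all
next
  fix y assume "y \<in> ?B"
  then obtain i j where "y = f i j" "1 \<le> i" "i \<le> j" "j \<le> 4 - 1" "R i" "S j"
    by (elim UnE; simp split: if_splits; fastforce)
  then show "y \<in> ?A" by blast
qed

text \<open>The subgroups are indexed by the retained part of {0, 1, 2, 3}: triples give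
  \<open>P\<close>, \<open>Q\<close>, \<open>D1\<close>, \<open>D2\<close>, pairs give cyclic
  groups, smaller sets the trivial group. Since \<open>D1\<close> and \<open>D2\<close> are
  dihedral, every intersection reduces to \<open>c_ab\<close>, \<open>a_bc\<close>,
  \<open>ab_bc\<close> and the exclusion \<open>mixed\<close>.\<close>

lemma (in group) intersection_property_rank4:
  assumes fin: "finite (carrier G)"
    and abc [simp]: "a \<in> carrier G" "b \<in> carrier G" "c \<in> carrier G" and nt: "a \<noteq> \<one>" "b \<noteq> \<one>" "c \<noteq> \<one>"
    and inv2: "(a \<otimes> b) \<otimes> (a \<otimes> b) = \<one>" "(b \<otimes> c) \<otimes> (b \<otimes> c) = \<one>"
      "(a \<otimes> (b \<otimes> c)) \<otimes> (a \<otimes> (b \<otimes> c)) = \<one>"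
    and inv_nt: "a \<otimes> b \<noteq> \<one>" "b \<otimes> c \<noteq> \<one>" "a \<otimes> (b \<otimes> c) \<noteq> \<one>"
    and c_ab: "generate G {c} \<inter> generate G {a, b} \<subseteq> {\<one>}"
    and a_bc: "generate G {a} \<inter> generate G {b, c} \<subseteq> {\<one>}"
    and ab_bc: "generate G {a, b} \<inter> generate G {b, c} \<subseteq> generate G {b}"
    and mixed: "\<And>y z. y \<in> generate G {a} \<Longrightarrow> z \<in> generate G {c} \<Longrightarrow> y \<noteq> (a \<otimes> (b \<otimes> c)) \<otimes> z"
  shows "intersection_property G 4 [a, b, c]"
proof -
  define u where "u = a \<otimes> b"
  define w where "w = b \<otimes> c"
  define t where "t = a \<otimes> (b \<otimes> c)"
  have uwt [simp]: "u \<in> carrier G" "w \<in> carrier G" "t \<in> carrier G"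
    by (simp_all add: u_def w_def t_def)
  have sq: "u \<otimes> u = \<one>" "w \<otimes> w = \<one>" "t \<otimes> t = \<one>" and uwt1: "u \<noteq> \<one>" "w \<noteq> \<one>" "t \<noteq> \<one>"
    using inv2 inv_nt by (simp_all add: u_def w_def t_def)
  have t_aw: "t = a \<otimes> w" and t_uc: "t = u \<otimes> c" by (simp_all add: t_def u_def w_def m_assoc)
  define E where "E = {\<one>}"
  \<comment> \<open>The digits are the retained indices. In the same way \<open>P\<close>,
    \<open>Q\<close>, \<open>D1\<close>, \<open>D2\<close> retain 012, 123, 013, 023, and
    \<open>F\<close> retains all four.\<close>
  define C01 where "C01 = generate G {a}"
  define C12 where "C12 = generate G {b}"
  define C23 where "C23 = generate G {c}"
  define C02 where "C02 = generate G {u}"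
  define C13 where "C13 = generate G {w}"
  define C03 where "C03 = generate G {t}"
  define P where "P = generate G {a, b}"
  define Q where "Q = generate G {b, c}"
  define D1 where "D1 = generate G {a, t}"
  define D2 where "D2 = generate G {c, t}"
  define F where "F = generate G {a, b, c}"
  note defs = C01_def C12_def C23_def C02_def C13_def C03_def P_def Q_def D1_def D2_def F_def
  have sub: "subgroup C01 G" "subgroup C12 G" "subgroup C23 G" "subgroup C02 G" "subgroup C13 G"
    "subgroup C03 G" "subgroup P G" "subgroup Q G" "subgroup D1 G" "subgroup D2 G" "subgroup F G"
    unfolding defs by (simp_all add: generate_is_subgroup)
  have mult: "y \<otimes> z \<in> H" and minv: "inv y \<in> H" if "subgroup H G" "y \<in> H" "z \<in> H" for H y z
    using that by (simp_all add: subgroup.m_closed subgroup.m_inv_closed)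
  have cancel_left: "z \<in> H" if "subgroup H G" "y \<in> H" "y \<otimes> z \<in> H" "z \<in> carrier G" for H y z
  proof -
    have "y \<in> carrier G" using that subgroup.subset by blast
    then have "z = inv y \<otimes> (y \<otimes> z)" using that by (simp add: m_assoc[symmetric])
    then show ?thesis using that mult minv by metis
  qed
  have cancel_right: "y \<in> H" if "subgroup H G" "z \<in> H" "y \<otimes> z \<in> H" "y \<in> carrier G" for H y z
  proof -
    have "z \<in> carrier G" using that subgroup.subset by blast
    then have "y = (y \<otimes> z) \<otimes> inv z" using that by (simp add: m_assoc)
    then show ?thesis using that mult minv by metis
  qed
  have one: "\<one> \<in> H" if "subgroup H G" for H using that by (rule subgroup.one_closed)
  have gen: "a \<in> C01" "b \<in> C12" "c \<in> C23" "u \<in> C02" "w \<in> C13" "t \<in> C03"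
    "a \<in> P" "b \<in> P" "b \<in> Q" "c \<in> Q" "a \<in> D1" "t \<in> D1" "c \<in> D2" "t \<in> D2" "a \<in> F" "b \<in> F" "c \<in> F"
    unfolding defs by (auto intro: generate.incl)
  have uP: "u \<in> P" and wQ: "w \<in> Q" using mult sub gen by (simp_all add: u_def w_def)
  have wD1: "w \<in> D1" using cancel_left[OF sub(9) gen(11)] gen t_aw by simp
  have uD2: "u \<in> D2" using cancel_right[OF sub(10) gen(13)] gen t_uc by simp
  have incl: "C01 \<subseteq> P" "C12 \<subseteq> P" "C02 \<subseteq> P" "C12 \<subseteq> Q" "C23 \<subseteq> Q" "C13 \<subseteq> Q"
    "C01 \<subseteq> D1" "C13 \<subseteq> D1" "C03 \<subseteq> D1" "C02 \<subseteq> D2" "C23 \<subseteq> D2" "C03 \<subseteq> D2"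
    unfolding C01_def C12_def C23_def C02_def C13_def C03_def
    using sub gen uP wQ wD1 uD2 by (simp_all add: generate_subgroup_incl)
  have PF: "P \<subseteq> F" and QF: "Q \<subseteq> F" unfolding P_def Q_def
    using sub gen by (simp_all add: generate_subgroup_incl)
  have tF: "t \<in> F" using mult[OF sub(11)] gen by (simp add: t_def)
  have DF: "D1 \<subseteq> F" "D2 \<subseteq> F" unfolding D1_def D2_def
    using sub gen tF by (simp_all add: generate_subgroup_incl)
  have carr: "y \<in> carrier G" if "y \<in> F" for y using that sub(11) subgroup.subset by blast
  have carr': "y \<in> carrier G" if "y \<in> C01 \<or> y \<in> C23" for y using that carr incl PF QF by blast
  have cP: "y = \<one>" if "y \<in> C23" "y \<in> P" for y using c_ab that by (auto simp: defs)
  have aQ: "y = \<one>" if "y \<in> C01" "y \<in> Q" for y using a_bc that by (auto simp: defs)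
  have PQ: "y \<in> C12" if "y \<in> P" "y \<in> Q" for y using ab_bc that by (auto simp: defs)
  have mixed': "y \<noteq> t \<otimes> z" if "y \<in> C01" "z \<in> C23" for y z using mixed that by (simp add: defs t_def)
  have cyc2: "generate G {g} = {\<one>, g}" if "g \<in> carrier G" "g \<otimes> g = \<one>" for g
  proof
    have "inv g = g" using that by (simp add: inv_equality)
    then have "subgroup {\<one>, g} G" using that by (intro subgroupI) auto
    then show "generate G {g} \<subseteq> {\<one>, g}" by (rule generate_subgroup_incl[rotated]) simp
  qed (auto intro: generate.one generate.incl)
  have inv2': "C02 = {\<one>, u}" "C13 = {\<one>, w}" "C03 = {\<one>, t}"
    using cyc2 sq by (simp_all add: defs)
  have cnP: "c \<notin> P" and anQ: "a \<notin> Q" using cP aQ gen nt by blast+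
  have bnC: "b \<notin> C01" "b \<notin> C23" using cP aQ gen nt by blast+
  have tnP: "t \<notin> P" using cancel_left[OF sub(7) uP _ abc(3)] cnP t_uc by blast
  have tnQ: "t \<notin> Q" using cancel_right[OF sub(8) wQ _ abc(1)] anQ t_aw by blast
  have wnP: "w \<notin> P" using cancel_left[OF sub(7) gen(8) _ abc(3)] cnP w_def by blast
  have unQ: "u \<notin> Q" using cancel_right[OF sub(8) gen(9) _ abc(1)] anQ u_def by blast
  have ut: "u \<noteq> t" using t_uc nt r_cancel_one'[of u c] by auto
  have wt: "w \<noteq> t" using t_aw nt l_cancel_one'[of a w] by auto
  have ne: "w \<notin> C01" "u \<notin> C01" "u \<notin> C23" "w \<notin> C23" "u \<noteq> w" "t \<notin> C01" "t \<notin> C12" "t \<notin> C23" "w \<notin> C12" "u \<notin> C12"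
  proof -
    show "u \<noteq> w" using unQ wQ by blast
    show "u \<notin> C01" using cancel_left[OF sub(1) gen(1) _ abc(2)] bnC u_def by blast
    show "w \<notin> C23" using cancel_right[OF sub(3) gen(3) _ abc(2)] bnC w_def by blast
    show "u \<notin> C23" "t \<notin> C23" "u \<notin> C12" using unQ tnQ incl(4,5) by blast+
    show "w \<notin> C01" "t \<notin> C01" "t \<notin> C12" "w \<notin> C12" using wnP tnP incl(1,2) by blast+
  qed
  have le: "E \<subseteq> C01" "E \<subseteq> C12" "E \<subseteq> C23" "E \<subseteq> C02" "E \<subseteq> C13" "E \<subseteq> C03" "E \<subseteq> P" "E \<subseteq> Q" "E \<subseteq> D1"
    "E \<subseteq> D2" "E \<subseteq> F"
    using sub one by (simp_all add: E_def)
  have cF: "C01 \<subseteq> F" "C12 \<subseteq> F" "C23 \<subseteq> F" "C02 \<subseteq> F" "C13 \<subseteq> F" "C03 \<subseteq> F"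
    using incl PF QF DF by blast+
  have cd0: "C01 \<inter> Q = E" "C23 \<inter> P = E"
  proof -
    have "C01 \<inter> Q \<subseteq> E" "C23 \<inter> P \<subseteq> E" using aQ cP by (auto simp: E_def)
    then show "C01 \<inter> Q = E" "C23 \<inter> P = E" using le by blast+
  qed
  have two: "H \<inter> {\<one>, g} = E" if "subgroup H G" "g \<notin> H" for H g
    using that one[OF that(1)] by (auto simp: E_def)
  have cc: "C01 \<inter> C12 = E" "C01 \<inter> C23 = E" "C12 \<inter> C23 = E" "C01 \<inter> C02 = E" "C01 \<inter> C13 = E" "C01 \<inter> C03 = E"
    "C12 \<inter> C02 = E" "C12 \<inter> C13 = E" "C12 \<inter> C03 = E"
    "C23 \<inter> C02 = E" "C23 \<inter> C13 = E" "C23 \<inter> C03 = E" "C02 \<inter> C13 = E" "C02 \<inter> C03 = E" "C13 \<inter> C03 = E"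
  proof -
    show "C01 \<inter> C12 = E" "C01 \<inter> C23 = E" using cd0(1) incl(4,5) le(1-3) by blast+
    show "C12 \<inter> C23 = E" using cd0(2) incl(2) le(2,3) by blast
    show "C01 \<inter> C02 = E" "C01 \<inter> C13 = E" "C01 \<inter> C03 = E"
      "C12 \<inter> C02 = E" "C12 \<inter> C13 = E" "C12 \<inter> C03 = E"
      "C23 \<inter> C02 = E" "C23 \<inter> C13 = E" "C23 \<inter> C03 = E"
      unfolding inv2' using sub ne by (simp_all add: two)
    show "C02 \<inter> C13 = E" "C02 \<inter> C03 = E" "C13 \<inter> C03 = E"
      unfolding inv2' E_def using ne(5) ut wt uwt1 by auto
  qed
  \<comment> \<open>\<open>t\<close> is an involution and a product of \<open>a\<close> with the
    involution \<open>w\<close>, and also of the involution \<open>u\<close> with \<open>c\<close>.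
    Hence conjugation by \<open>t\<close> inverts \<open>a\<close> and \<open>c\<close>.\<close>
  have inverting: "t \<otimes> a = inv a \<otimes> t" "t \<otimes> c = inv c \<otimes> t"
  proof -
    have inv: "inv u = u" "inv w = w" "inv t = t" using sq by (simp_all add: inv_equality)
    have "inv a \<otimes> t = w" by (simp add: t_aw m_assoc[symmetric])
    moreover have "t \<otimes> a = w"
    proof -
      have "t \<otimes> (a \<otimes> w) = \<one>" using sq t_aw by simp
      then have "t \<otimes> a = inv w" by (simp add: m_assoc[symmetric] inv_equality)
      then show ?thesis using inv by simp
    qed
    ultimately show "t \<otimes> a = inv a \<otimes> t" by simp
    have "inv t = inv c \<otimes> inv u" by (simp add: t_uc inv_mult_group)
    then have "t = inv c \<otimes> u" using inv by simp
    then have "inv c \<otimes> t = inv c \<otimes> (u \<otimes> c)" "t \<otimes> c = inv c \<otimes> u \<otimes> c" using t_uc by simp_all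
    then show "t \<otimes> c = inv c \<otimes> t" by (simp add: m_assoc)
  qed
  have D1E: "v \<in> C01 \<or> (\<exists>y\<in>C01. v = y \<otimes> t)" if "v \<in> D1" for v
    using that unfolding D1_def C01_def
    by (rule generate_dihedral[OF fin abc(1) uwt(3) sq(3) inverting(1)]) auto
  have D2E: "v \<in> C23 \<or> (\<exists>y\<in>C23. v = y \<otimes> t)" if "v \<in> D2" for v
    using that unfolding D2_def C23_def
    by (rule generate_dihedral[OF fin abc(3) uwt(3) sq(3) inverting(2)]) auto
  have dd1: "P \<inter> Q = C12" using PQ incl by blast
  \<comment> \<open>A reflection \<open>y \<otimes> t\<close> in \<open>P\<close> with
    \<open>y\<close> in \<open>C01\<close> would put \<open>t\<close> into \<open>P\<close>. The
    same argument serves for \<open>dd3\<close>.\<close>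
  have dd2: "P \<inter> D1 = C01"
  proof -
    have "v \<in> C01" if "v \<in> P" "v \<in> D1" for v
      using D1E[OF that(2)] that tnP cancel_left[OF sub(7)] incl by (metis subsetD uwt(3))
    then show ?thesis using incl by blast
  qed
  have dd3: "Q \<inter> D2 = C23"
  proof -
    have "v \<in> C23" if "v \<in> Q" "v \<in> D2" for v
      using D2E[OF that(2)] that tnQ cancel_left[OF sub(8)] incl by (metis subsetD uwt(3))
    then show ?thesis using incl by blast
  qed
  have dd4: "P \<inter> D2 = C02"
  proof -
    have "v \<in> C02" if v: "v \<in> P" "v \<in> D2" for v
      using D2E[OF v(2)]
    proof
      assume "v \<in> C23"
      then show ?thesis using cP v one sub by metis
    next
      assume "\<exists>y\<in>C23. v = y \<otimes> t"
      then obtain y where y: "y \<in> C23" "v = y \<otimes> t" by blast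
      \<comment> \<open>With \<open>t = inv c \<otimes> u\<close> the reflection becomes
        \<open>(y \<otimes> inv c) \<otimes> u\<close>. Its first factor lies in \<open>C23\<close>
        and in \<open>P\<close>, so it is trivial.\<close>
      have "inv t = inv c \<otimes> inv u" by (simp add: t_uc inv_mult_group)
      moreover have "inv u = u" "inv t = t" using sq by (simp_all add: inv_equality)
      ultimately have "t = inv c \<otimes> u" by simp
      then have vy: "v = (y \<otimes> inv c) \<otimes> u" using y carr' by (simp add: m_assoc)
      have yc: "y \<otimes> inv c \<in> C23" using y gen mult minv sub by metis
      moreover have "y \<otimes> inv c \<in> P"
        using cancel_right[OF sub(7) uP] v(1) vy yc carr' by metis
      ultimately have "y \<otimes> inv c = \<one>" by (rule cP)
      then show ?thesis using vy gen by simp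
    qed
    then show ?thesis using incl by blast
  qed
  have dd5: "Q \<inter> D1 = C13"
  proof -
    have "v \<in> C13" if v: "v \<in> Q" "v \<in> D1" for v
      using D1E[OF v(2)]
    proof
      assume "v \<in> C01"
      then show ?thesis using aQ v one sub by metis
    next
      assume "\<exists>y\<in>C01. v = y \<otimes> t"
      then obtain y where y: "y \<in> C01" "v = y \<otimes> t" by blast
      then have vy: "v = (y \<otimes> a) \<otimes> w" using carr' by (simp add: m_assoc t_aw)
      have ya: "y \<otimes> a \<in> C01" using y gen mult sub by metis
      moreover have "y \<otimes> a \<in> Q"
        using cancel_right[OF sub(8) wQ] v(1) vy ya carr' by metis
      ultimately have "y \<otimes> a = \<one>" by (rule aQ)
      then show ?thesis using vy gen by simp
    qed
    then show ?thesis using incl by blast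
  qed
  \<comment> \<open>A rotation of one dihedral group that is a reflection of the other contradicts
    \<open>mixed\<close>, once \<open>t\<close> is moved to the left by inversion. Equal reflections
    have equal rotation parts, which lie in \<open>C01\<close> and \<open>C23\<close> and so are
    trivial.\<close>
  have dd6: "D1 \<inter> D2 = C03"
  proof -
    have ac: "y = \<one>" if "y \<in> C01" "y \<in> C23" for y using that aQ incl by blast
    have ct: "t \<otimes> z = inv z \<otimes> t" if "z \<in> C23" for z
      using inverting_generate[OF fin abc(3) uwt(3) inverting(2)] that by (simp add: C23_def)
    have "v \<in> C03" if v: "v \<in> D1" "v \<in> D2" for v
    proof -
      from D1E[OF v(1)] D2E[OF v(2)] consider "v \<in> C01" "v \<in> C23"
        | z where "v \<in> C01" "z \<in> C23" "v = z \<otimes> t" | y where "y \<in> C01" "v = y \<otimes> t" "v \<in> C23"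
        | y z where "y \<in> C01" "z \<in> C23" "v = y \<otimes> t" "v = z \<otimes> t" by blast
      then show ?thesis
      proof cases
        case 1
        then show ?thesis using ac one sub by metis
      next
        case 2
        then have "v = t \<otimes> inv z" using ct[of "inv z"] minv sub carr' by simp
        then show ?thesis using 2 mixed' minv sub by metis
      next
        case 3
        then have "v \<otimes> t = y" using carr' sq by (simp add: m_assoc)
        moreover have "v \<otimes> t = t \<otimes> inv v" using 3 ct[of "inv v"] minv sub carr' by simp
        ultimately show ?thesis using 3 mixed' minv sub by metis
      next
        case 4
        then have "y = z" using carr' by simp
        then have "y = \<one>" using 4 ac by simp
        then show ?thesis using 4 gen by simp
      qed
    qed
    then show ?thesis using incl by blast
  qed
  note dd = dd1 dd2 dd3 dd4 dd5 dd6
  have cd: "C02 \<inter> Q = E" "C02 \<inter> D1 = E" "C03 \<inter> P = E" "C03 \<inter> Q = E" "C13 \<inter> P = E" "C13 \<inter> D2 = E"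
    "C12 \<inter> D1 = E" "C12 \<inter> D2 = E" "C01 \<inter> D2 = E" "C23 \<inter> D1 = E"
  proof -
    show "C02 \<inter> Q = E" using incl(3) dd(1) cc(7) by blast
    show "C02 \<inter> D1 = E" using incl(3) dd(2) cc(4) by blast
    show "C03 \<inter> P = E" using incl(9) dd(2) cc(6) by blast
    show "C03 \<inter> Q = E" using incl(9) dd(5) cc(15) by blast
    show "C13 \<inter> P = E" using incl(8) dd(2) cc(5) by blast
    show "C13 \<inter> D2 = E" using incl(6) dd(3) cc(11) by blast
    show "C12 \<inter> D1 = E" using incl(2) dd(2) cc(1) by blast
    show "C12 \<inter> D2 = E" using incl(2) dd(4) cc(7) by blast
    show "C01 \<inter> D2 = E" using incl(1) dd(4) cc(4) by blast
    show "C23 \<inter> D1 = E" using incl(5) dd(5) cc(11) by blast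
  qed
  have ss: "C \<inter> D = C" "D \<inter> C = C" if "C \<subseteq> D" for C D :: "'a set" using that by auto
  have sg: "generate G {a, b, u} = P" "generate G {b, c, w} = Q" "generate G {a, w, t} = D1"
    "generate G {c, u, t} = D2" "generate G {a, b, c, u, w, t} = F" "generate G {} = E"
  proof -
    have *: "generate G S = generate G S'"
      if "S' \<subseteq> S" "S \<subseteq> generate G S'" "S' \<subseteq> carrier G" for S S'
      using that mono_generate[of S' S] generate_subgroup_incl[of S "generate G S'"]
        generate_is_subgroup[of S'] by blast
    show "generate G {a, b, u} = P" "generate G {b, c, w} = Q" "generate G {a, w, t} = D1"
      "generate G {c, u, t} = D2" "generate G {a, b, c, u, w, t} = F"
      unfolding P_def Q_def D1_def D2_def F_def
      using gen uP wQ wD1 uD2 tF PF QF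
      by (intro *; auto simp: P_def[symmetric] Q_def[symmetric] D1_def[symmetric] D2_def[symmetric] F_def[symmetric])+
    show "generate G {} = E" using generate_empty by (simp add: E_def)
  qed
  \<comment> \<open>The truth values tell which of 0, 1, 2, 3 are retained; a union of excluded sets
    then becomes a componentwise conjunction.\<close>
  define gg where "gg i j k l = generate G ((if i \<and> j then {a} else {}) \<union> (if j \<and> k then {b} else {}) \<union>
      (if k \<and> l then {c} else {}) \<union> (if i \<and> k then {u} else {}) \<union> (if j \<and> l then {w} else {}) \<union>
      (if i \<and> l then {t} else {}))" for i j k l
  have tau: "tau_subgroup G 4 [a, b, c] I = gg (0 \<notin> I) (1 \<notin> I) (2 \<notin> I) (3 \<notin> I)" for I
    unfolding tau_subgroup_def gg_def rank4_index_pairs[where R = "\<lambda>i. i - 1 \<notin> I" and S = "\<lambda>j. j \<notin> I"]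
    by (simp add: tau_rank4 u_def w_def t_def)
  have vals: "gg True True True True = F" "gg True True True False = P" "gg True True False True = D1"
    "gg True False True True = D2" "gg False True True True = Q" "gg True True False False = C01"
    "gg True False True False = C02" "gg True False False True = C03" "gg False True True False = C12"
    "gg False True False True = C13" "gg False False True True = C23" "gg True False False False = E"
    "gg False True False False = E" "gg False False True False = E" "gg False False False True = E"
    "gg False False False False = E"
    using sg by (simp_all add: gg_def C01_def C12_def C23_def C02_def C13_def C03_def insert_commute)
  note inter = cc dd cd cd0 cc[THEN trans[OF Int_commute]] dd[THEN trans[OF Int_commute]]
    cd[THEN trans[OF Int_commute]] cd0[THEN trans[OF Int_commute]]
    le[THEN ss(1)] le[THEN ss(2)] cF[THEN ss(1)] cF[THEN ss(2)] incl[THEN ss(1)] incl[THEN ss(2)]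
    PF[THEN ss(1)] PF[THEN ss(2)] QF[THEN ss(1)] QF[THEN ss(2)] DF[THEN ss(1)] DF[THEN ss(2)]
  \<comment> \<open>All 256 cases are looked up in the table \<open>inter\<close>, which lists the
    intersections in both orders.\<close>
  have key: "gg i j k l \<inter> gg i' j' k' l' = gg (i \<and> i') (j \<and> j') (k \<and> k') (l \<and> l')" for i j k l i' j' k' l'
    by (cases i; cases j; cases k; cases l; cases i'; cases j'; cases k'; cases l';
        simp only: vals simp_thms inter Int_absorb)
  then show ?thesis by (simp add: intersection_property_def tau)
qed

text \<open>The hypothesis is a commutator identity cleared of the inverses of \<open>y\<close> and
  \<open>a\<close>. In this form it can be checked by plain matrix products and carried through a
  homomorphism.\<close>

lemma (in group) commutator_eqI:
  assumes "z \<otimes> a \<otimes> y = y \<otimes> a" "a \<in> carrier G" "y \<in> carrier G" "z \<in> carrier G"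
  shows "z = y \<otimes> a \<otimes> inv y \<otimes> inv a"
proof -
  have "z = (z \<otimes> a \<otimes> y) \<otimes> inv y \<otimes> inv a" using assms(2-4) by (simp add: m_assoc)
  then show ?thesis using assms(1) by simp
qed


section \<open>Primitive elements of finite fields\<close>

locale primitive =
  fixes x :: "'a::{field,finite}"
  assumes primitive: "primitive_element x"
begin

lemma x_nz [simp]: "x \<noteq> 0"
proof -
  have "x powi 1 \<in> range (\<lambda>k::int. x powi k)" by blast
  then show ?thesis using primitive by (auto simp: primitive_element_def)
qed

text \<open>Let \<open>m\<close> be the least positive exponent with \<open>x ^ m = 1\<close>.
  Negative exponents reduce to natural ones, and the powers below \<open>m\<close> are distinct and
  exhaust the nonzero elements; counting gives \<open>m = CARD('a) - 1\<close>.\<close>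

lemma power_eq_one_iff: "x ^ n = 1 \<longleftrightarrow> (CARD('a) - 1) dvd n"
  and ex_power: "y \<noteq> 0 \<Longrightarrow> \<exists>n. y = x ^ n"
proof -
  have "\<not> inj (\<lambda>n::nat. x ^ n)"
    using finite_imageD[of "\<lambda>n::nat. x ^ n" UNIV] by auto
  then obtain i j :: nat where ij: "i < j" "x ^ i = x ^ j"
    by (auto simp: inj_def) (metis linorder_neqE_nat)
  then have "x ^ i * x ^ (j - i) = x ^ i * 1"
    by (metis le_add_diff_inverse less_imp_le mult_1_right power_add)
  then have ex: "0 < j - i \<and> x ^ (j - i) = 1" using ij by simp
  define m where "m = (LEAST m. 0 < m \<and> x ^ m = 1)"
  have m: "0 < m" "x ^ m = 1"
    using LeastI[where P = "\<lambda>m. 0 < m \<and> x ^ m = 1", OF ex] by (auto simp: m_def)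
  have least: "x ^ n \<noteq> 1" if "0 < n" "n < m" for n
    using not_less_Least[of n "\<lambda>m. 0 < m \<and> x ^ m = 1"] that by (auto simp: m_def)
  have "x ^ n = x ^ (m * (n div m) + n mod m)" for n by simp
  then have red: "x ^ n = x ^ (n mod m)" for n
    by (simp only: power_add power_mult m power_one mult_1_left)
  have dvd: "x ^ n = 1 \<longleftrightarrow> m dvd n" for n
    using red[of n] least[of "n mod m"] m by (auto simp: dvd_eq_mod_eq_0)
  have surj: "\<exists>n. y = x ^ n" if "y \<noteq> 0" for y
  proof -
    from that primitive have "y \<in> range (\<lambda>k::int. x powi k)"
      unfolding primitive_element_def by blast
    then obtain k where k: "y = x powi k" by blast
    have inv: "inverse x = x ^ (m - 1)"
      by (metis One_nat_def Suc_pred inverse_unique m power_Suc)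
    show ?thesis
    proof (cases "k \<ge> 0")
      case True
      then show ?thesis using k by (auto simp: power_int_def)
    next
      case False
      then show ?thesis using k by (auto simp: power_int_def inv simp flip: power_mult)
    qed
  qed
  have "inj_on (\<lambda>n. x ^ n) {..<m}"
  proof (rule linorder_inj_onI)
    fix i j assume *: "i < j" "i \<in> {..<m}" "j \<in> {..<m}"
    show "x ^ i \<noteq> x ^ j"
    proof
      assume "x ^ i = x ^ j"
      then have "x ^ i * x ^ (j - i) = x ^ i * 1" using *
        by (metis le_add_diff_inverse less_imp_le mult_1_right power_add)
      then have "x ^ (j - i) = 1" by simp
      then show False using least[of "j - i"] * by (meson diff_le_self lessThan_iff order_le_less_trans zero_less_diff)
    qed
  qed auto
  moreover have "(\<lambda>n. x ^ n) ` {..<m} = UNIV - {0}"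
  proof (intro equalityI subsetI)
    fix y assume "y \<in> UNIV - {0::'a}"
    then obtain n where "y = x ^ n" using surj by auto
    then show "y \<in> (\<lambda>n. x ^ n) ` {..<m}" using red[of n] m by auto
  qed auto
  ultimately have "card (UNIV - {0::'a}) = m"
    by (metis card_image card_lessThan)
  then have "m = CARD('a) - 1" by (simp add: card_Diff_singleton)
  then show "x ^ n = 1 \<longleftrightarrow> (CARD('a) - 1) dvd n" using dvd by simp
  show "y \<noteq> 0 \<Longrightarrow> \<exists>n. y = x ^ n" by (rule surj)
qed

text \<open>Every nonzero element is a power of \<open>x\<close>, so a property of all of them
  follows from its stability under multiplication by \<open>x\<close>.\<close>

lemma nonzero_induct [consumes 1, case_names one mult]:
  assumes "y \<noteq> 0" and "P 1" and "\<And>y. y \<noteq> 0 \<Longrightarrow> P y \<Longrightarrow> P (x * y)"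
  shows "P y"
proof -
  have "P (x ^ n)" for n
    by (induction n) (use assms(2,3) in auto)
  then show ?thesis using ex_power[OF assms(1)] by auto
qed

end

locale primitive_ge5 = primitive x for x :: "'a::{field,finite}" +
  assumes card_ge5: "CARD('a) \<ge> 5"
begin

lemma power_neq_one: "0 < n \<Longrightarrow> n < 4 \<Longrightarrow> x ^ n \<noteq> 1"
  using card_ge5 by (auto simp: power_eq_one_iff dest: dvd_imp_le)

text \<open>As \<open>CARD('a) - 1\<close> is at least 4, the first three powers of \<open>x\<close>
  differ from 1, and \<open>x = - 1\<close> would give \<open>x * x = 1\<close>. These are the
  nondegeneracy facts on which the later matrix arguments rest.\<close>

lemma x_neq [simp]: "x \<noteq> 1" "x * x \<noteq> 1" "x * (x * x) \<noteq> 1" "x \<noteq> - 1" "- 1 \<noteq> x" "1 + x \<noteq> 0"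
proof -
  show "x \<noteq> 1" "x * x \<noteq> 1" "x * (x * x) \<noteq> 1"
    using power_neq_one[of 1] power_neq_one[of 2] power_neq_one[of 3]
    by (auto simp: power2_eq_square power3_eq_cube mult.assoc)
  then show "x \<noteq> - 1" "- 1 \<noteq> x" by auto
  then show "1 + x \<noteq> 0" by (metis add.inverse_unique)
qed


section \<open>The stabiliser of two points\<close>

definition A :: "'a^3^3" where "A = mat3 x 1 0  0 (1 + inverse x) (- inverse x)  0 1 0"
definition B :: "'a^3^3" where "B = mat3 (- inverse x) 0 0  0 0 1  0 x 0"
definition C :: "'a^3^3" where "C = mat3 x 0 0  (x - inverse x) 1 0  (x - inverse x) 0 (inverse x)"

text \<open>In \<open>L\<close> the second and third columns are multiples of e2 and e3, in
  \<open>W\<close> of e3 and e2. The invertible ones among these matrices fix, respectively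
  exchange, the points spanned by e2 and e3.\<close>

abbreviation L :: "'a \<Rightarrow> 'a \<Rightarrow> 'a \<Rightarrow> 'a \<Rightarrow> 'a \<Rightarrow> 'a^3^3" where
  "L a b c d e \<equiv> mat3 a 0 0 b c 0 d 0 e"
abbreviation W :: "'a \<Rightarrow> 'a \<Rightarrow> 'a \<Rightarrow> 'a \<Rightarrow> 'a \<Rightarrow> 'a^3^3" where
  "W a b c d e \<equiv> mat3 a 0 0 b 0 c d e 0"

lemma ABC_SL [simp]: "A \<in> carrier SL" "B \<in> carrier SL" "C \<in> carrier SL"
  by (simp_all add: carrier_SL A_def B_def C_def)

definition Stab :: "('a^3^3) set" where
  "Stab = {M \<in> carrier SL. (\<exists>a b c d e. M = L a b c d e) \<or> (\<exists>a b c d e. M = W a b c d e)}"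

lemma L_Stab: "L a b c d e \<in> Stab \<longleftrightarrow> a * c * e = 1"
  and W_Stab: "W a b c d e \<in> Stab \<longleftrightarrow> a * c * e = - 1"
  by (auto simp: Stab_def carrier_SL minus_equation_iff[of _ 1])

lemma Stab_cases:
  assumes "M \<in> Stab"
  obtains (L) a b c d e where "M = L a b c d e" "a * c * e = 1"
  | (W) a b c d e where "M = W a b c d e" "a * c * e = - 1"
  using assms by (auto simp: Stab_def carrier_SL minus_equation_iff[of _ 1])

lemma L_inv:
  assumes "a * c * e = 1"
  shows "inv\<^bsub>SL\<^esub> (L a b c d e) = L (inverse a) (- b / (a * c)) (inverse c) (- d / (a * e)) (inverse e)"
proof (rule SL_inv_eqI)
  have "a \<noteq> 0" "c \<noteq> 0" "e \<noteq> 0" using assms by auto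
  then show "L a b c d e ** L (inverse a) (- b / (a * c)) (inverse c) (- d / (a * e)) (inverse e) = mat 1"
    by (simp add: mat_eq_mat3 field_simps)
qed (use assms in \<open>simp add: carrier_SL\<close>)

lemma W_inv:
  assumes "a * c * e = - 1"
  shows "inv\<^bsub>SL\<^esub> (W a b c d e) = W (inverse a) (- d / (a * e)) (inverse e) (- b / (a * c)) (inverse c)"
proof (rule SL_inv_eqI)
  have "a \<noteq> 0" "c \<noteq> 0" "e \<noteq> 0" using assms by auto
  then show "W a b c d e ** W (inverse a) (- d / (a * e)) (inverse e) (- b / (a * c)) (inverse c) = mat 1"
    by (simp add: mat_eq_mat3 field_simps)
qed (use assms in \<open>simp add: carrier_SL\<close>)

lemma subgroup_Stab: "subgroup Stab SL"
proof (rule SL.subgroupI)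
  show "Stab \<subseteq> carrier SL" by (auto simp: Stab_def)
  show "Stab \<noteq> {}" using L_Stab[of 1 0 1 0 1] by auto
  show "inv\<^bsub>SL\<^esub> M \<in> Stab" if "M \<in> Stab" for M
    using that
  proof (cases rule: Stab_cases)
    case (L a b c d e)
    then have "inverse a * inverse c * inverse e = 1"
      by (metis inverse_1 inverse_mult_distrib)
    with L show ?thesis by (simp add: L_inv L_Stab)
  next
    case (W a b c d e)
    then have "inverse a * inverse e * inverse c = inverse (- 1)"
      by (metis inverse_mult_distrib mult.assoc mult.commute)
    with W show ?thesis by (simp add: W_inv W_Stab)
  qed
  show "M \<otimes>\<^bsub>SL\<^esub> N \<in> Stab" if M: "M \<in> Stab" and N: "N \<in> Stab" for M N
  proof -
    have "M ** N \<in> carrier SL" 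
      using SL.m_closed[of M N] M N by (auto simp: Stab_def)
    with M N show ?thesis by (auto simp: Stab_def)
  qed
qed

lemma BC_Stab: "B \<in> Stab" "C \<in> Stab"
  by (simp_all add: B_def C_def L_Stab W_Stab)

text \<open>The generated group is shown to contain first all elations \<open>N b d\<close>, then
  every diagonal part, and finally the swapping matrices by means of \<open>B\<close>.\<close>

lemma Stab_generate: "generate SL {B, C} = Stab"
proof
  show "generate SL {B, C} \<subseteq> Stab"
    by (rule SL.generate_subgroup_incl[OF _ subgroup_Stab]) (simp add: BC_Stab)
  let ?H = "generate SL {B, C}"
  have H: "subgroup ?H SL" by (rule SL.generate_is_subgroup) simp
  have mult: "M ** N \<in> ?H" if "M \<in> ?H" "N \<in> ?H" for M N
    using subgroup.m_closed[OF H that] by simp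
  have one: "mat 1 \<in> ?H" using subgroup.one_closed[OF H] by simp
  have BH: "B \<in> ?H" and CH: "C \<in> ?H" by (auto intro: generate.incl)
  have "inv\<^bsub>SL\<^esub> B = W (- x) 0 (inverse x) 0 1" "inv\<^bsub>SL\<^esub> C = L (inverse x) (inverse x * inverse x - 1) 1 (inverse x - x) x"
    unfolding B_def C_def by (subst W_inv L_inv; simp add: field_simps)+
  then have BiH: "W (- x) 0 (inverse x) 0 1 \<in> ?H"
    and CiH: "L (inverse x) (inverse x * inverse x - 1) 1 (inverse x - x) x \<in> ?H"
    using subgroup.m_inv_closed[OF H] BH CH by metis+
  \<comment> \<open>Conjugation by \<open>B\<close> interchanges the last two coordinates, so
    \<open>D\<close> is a second triangular element, with the last two diagonal entries of
    \<open>C\<close> exchanged.\<close>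
  define D where "D = L x (1 - x * x) (inverse x) (x - x * x * x) 1"
  have "D = B ** C ** W (- x) 0 (inverse x) 0 1"
    by (simp add: B_def C_def D_def field_simps)
  then have DH: "D \<in> ?H" using mult BH CH BiH by simp
  have "inv\<^bsub>SL\<^esub> D = L (inverse x) (x * x - 1) x (x * x - 1) 1"
    unfolding D_def by (subst L_inv) (simp_all add: field_simps)
  then have DiH: "L (inverse x) (x * x - 1) x (x * x - 1) 1 \<in> ?H"
    using subgroup.m_inv_closed[OF H DH] by metis
  define N where "N = (\<lambda>b d. L 1 b 1 d 1)"
  have N_add: "N (b + b') (d + d') \<in> ?H" if "N b d \<in> ?H" "N b' d' \<in> ?H" for b b' d d'
    using mult[OF that] by (simp add: N_def add.commute)
  have N_diff: "N (b - b') (d - d') \<in> ?H" if "N b d \<in> ?H" "N b' d' \<in> ?H" for b b' d d'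
  proof -
    have "inv\<^bsub>SL\<^esub> (N b' d') = N (- b') (- d')"
      unfolding N_def by (subst L_inv) simp_all
    then have "N (- b') (- d') \<in> ?H" using subgroup.m_inv_closed[OF H that(2)] by metis
    from N_add[OF that(1) this] show ?thesis by simp
  qed
  \<comment> \<open>Conjugation by the inverses of \<open>C\<close> and \<open>D\<close> scales the
    two coordinates of an elation by \<open>x\<close>, \<open>x * x\<close> and by
    \<open>x * x\<close>, \<open>x\<close>. Conjugation by \<open>B\<close> exchanges them up to
    factors.\<close>
  have N_C: "N (x * b) (x * x * d) \<in> ?H" if "N b d \<in> ?H" for b d
    using mult[OF mult[OF CiH that] CH] by (simp add: C_def N_def field_simps)
  have N_D: "N (x * x * b) (x * d) \<in> ?H" if "N b d \<in> ?H" for b d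
    using mult[OF mult[OF DiH that] DH] by (simp add: D_def N_def field_simps)
  have N_B: "N (- x * d) (- (x * x * b)) \<in> ?H" if "N b d \<in> ?H" for b d
    using mult[OF mult[OF BH that] BiH] by (simp add: B_def N_def field_simps)
  \<comment> \<open>The diagonal parts of \<open>D\<close> and \<open>C\<close> commute, so their
    commutator is an elation, namely \<open>N b0 (x * b0)\<close>. It is nontrivial because
    \<open>x * x\<close> and \<open>x * x * x\<close> differ from 1.\<close>
  define b0 where "b0 = (1 - x * x) * (x * x * x - 1) / (x * x * x * x)"
  have b0: "b0 \<noteq> 0" by (simp add: b0_def mult.assoc)
  have "N b0 (x * b0) = D ** C ** L (inverse x) (x * x - 1) x (x * x - 1) 1
      ** L (inverse x) (inverse x * inverse x - 1) 1 (inverse x - x) x"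
    by (simp add: N_def b0_def D_def C_def) (simp add: field_simps)
  then have "N b0 (x * b0) \<in> ?H"
    using mult DH CH CiH DiH by simp
  \<comment> \<open>Two applications of \<open>N_C\<close> and one of \<open>N_D\<close> both scale
    the first coordinate by \<open>x * x\<close>, so the difference keeps only a second
    coordinate.\<close>
  from N_diff[OF N_C[OF N_C[OF this]] N_D[OF this]]
  have N0: "N 0 (x * x * b0 * (x * (x * x) - 1)) \<in> ?H"
    by (simp add: algebra_simps)
  define d0 where "d0 = x * x * b0 * (x * (x * x) - 1)"
  have d0: "d0 \<noteq> 0" using b0 by (simp add: d0_def)
  have "N 0 (y * d0) \<in> ?H" if "y \<noteq> 0" for y
    using that
  proof (induction rule: nonzero_induct)
    case one
    then show ?case using N0 by (simp add: d0_def)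
  next
    case (mult y)
    then show ?case using N_D[OF mult(2)] by (simp add: mult.assoc)
  qed
  from this[of "_ / d0"] have N0: "N 0 y \<in> ?H" for y
    using d0 one by (cases "y = 0") (auto simp: N_def mat_eq_mat3)
  have "N y 0 \<in> ?H" for y
    using N_B[OF N0[of "- y / x"]] by simp
  from N_add[OF this N0] have NH: "N b d \<in> ?H" for b d by simp
  \<comment> \<open>Left multiplication by the inverse of \<open>D\<close> scales the entry
    \<open>c\<close> by \<open>x\<close> and keeps \<open>e\<close>; the inverse of \<open>C\<close>
    does the reverse. Together they reach all pairs \<open>c\<close>, \<open>e\<close>; the
    determinant then forces \<open>a\<close>, and elations correct the remaining two
    entries.\<close>
  have torus_c: "\<exists>a b d. L a b c d 1 \<in> ?H" if "c \<noteq> 0" for c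
    using that
  proof (induction rule: nonzero_induct)
    case one
    then show ?case using \<open>mat 1 \<in> ?H\<close> unfolding mat_eq_mat3 by blast
  next
    case (mult c)
    then obtain a b d where "L a b c d 1 \<in> ?H" by auto
    from \<open>\<And>M N. M \<in> ?H \<Longrightarrow> N \<in> ?H \<Longrightarrow> M ** N \<in> ?H\<close>[OF DiH this] show ?case by auto
  qed
  have torus_e: "\<exists>a b d. L a b 1 d e \<in> ?H" if "e \<noteq> 0" for e
    using that
  proof (induction rule: nonzero_induct)
    case one
    then show ?case using \<open>mat 1 \<in> ?H\<close> unfolding mat_eq_mat3 by blast
  next
    case (mult e)
    then obtain a b d where "L a b 1 d e \<in> ?H" by auto
    from \<open>\<And>M N. M \<in> ?H \<Longrightarrow> N \<in> ?H \<Longrightarrow> M ** N \<in> ?H\<close>[OF CiH this] show ?case by auto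
  qed
  have LH: "L a b c d e \<in> ?H" if ace: "a * c * e = 1" for a b c d e
  proof -
    have ce: "c \<noteq> 0" "e \<noteq> 0" using ace by auto
    from torus_c[OF ce(1)] torus_e[OF ce(2)] obtain a1 b1 d1 a2 b2 d2 where
      "L a1 b1 c d1 1 \<in> ?H" "L a2 b2 1 d2 e \<in> ?H" by blast
    from mult[OF this] obtain a' b' d' where 1: "L a' b' c d' e \<in> ?H" by auto
    then have "L a' b' c d' e \<in> carrier SL" using subgroup.subset[OF H] by blast
    then have "a' * c * e = a * c * e" using ace by (simp add: carrier_SL)
    then have a': "a' = a" using ce by simp
    have "L a b c d e = L a' b' c d' e ** N ((b - b') / c) ((d - d') / e)"
      using ce by (simp add: N_def a')
    then show ?thesis using mult[OF 1 NH] by simp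
  qed
  show "Stab \<subseteq> ?H"
  proof
    fix M assume "M \<in> Stab"
    then show "M \<in> ?H"
    proof (cases rule: Stab_cases)
      case L
      then show ?thesis using LH by simp
    next
      case (W a b c d e)
      \<comment> \<open>\<open>B\<close> exchanges the two points, so dividing a swapping matrix by
        \<open>B\<close> on the right gives one of type \<open>L\<close>.\<close>
      have "M = L (- a * x) (- b * x) c (- d * x) (e / x) ** B"
        by (simp add: W B_def)
      moreover have "L (- a * x) (- b * x) c (- d * x) (e / x) \<in> ?H"
        using W by (intro LH) (simp add: mult.assoc)
      ultimately show ?thesis using mult BH by simp
    qed
  qed
qed


section \<open>A duality\<close>

text \<open>The symmetric solution of \<open>C P = P A\<^sup>T\<close> and \<open>B P = P B\<^sup>T\<close>.\<close>

definition P :: "'a^3^3" where "P = mat3 (inverse (x - inverse x)) 0 0  0 1 1  0 1 x"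
definition P' :: "'a^3^3" where
  "P' = mat3 (x - inverse x) 0 0  0 (x / (x - 1)) (- 1 / (x - 1))  0 (- 1 / (x - 1)) (1 / (x - 1))"

lemma x_minus_inverse [simp]: "x - inverse x \<noteq> 0" "x - 1 \<noteq> 0" "x \<noteq> inverse x"
  using x_neq(2) by (metis right_inverse right_minus_eq x_nz) (use x_neq in auto,
    metis right_inverse x_neq(2) x_nz)

lemma P_inv: "P ** P' = mat 1" "P' ** P = mat 1"
  by (simp_all add: P_def P'_def mat_eq_mat3 diff_divide_distrib[symmetric])

lemma transpose_P: "transpose P = P"
  by (simp add: P_def)

definition dual :: "'a^3^3 \<Rightarrow> 'a^3^3" where
  "dual M = P ** transpose (inv\<^bsub>SL\<^esub> M) ** P'"

text \<open>The equation says that \<open>D\<close> and \<open>M\<close> together preserve the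
  bilinear form \<open>P\<close>, which determines \<open>D\<close>. It lets duals be verified
  without computing an inverse.\<close>

lemma dual_eqI:
  assumes "M \<in> carrier SL" "D ** P ** transpose M = P"
  shows "dual M = D"
proof -
  have "transpose M ** transpose (inv\<^bsub>SL\<^esub> M) = mat 1"
    using SL_inv_left[OF assms(1)] by (metis transpose_mat transpose_mult)
  then have "P ** transpose (inv\<^bsub>SL\<^esub> M) = D ** P"
    by (metis assms(2) matrix_mul_assoc matrix_mul_rid)
  then show ?thesis
    by (metis P_inv(1) dual_def matrix_mul_assoc matrix_mul_rid)
qed

lemma dual_eq:
  assumes "M \<in> carrier SL"
  shows "dual M ** P ** transpose M = P"
proof -
  have "transpose (inv\<^bsub>SL\<^esub> M) ** transpose M = mat 1"
    using SL_inv_right[OF assms(1)] by (metis transpose_mat transpose_mult)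
  moreover have "dual M ** P = P ** transpose (inv\<^bsub>SL\<^esub> M)"
    by (metis P_inv(2) dual_def matrix_mul_assoc matrix_mul_rid)
  ultimately show ?thesis
    by (metis matrix_mul_assoc matrix_mul_rid)
qed

lemma dual_SL [simp]: "M \<in> carrier SL \<Longrightarrow> dual M \<in> carrier SL"
proof -
  assume M: "M \<in> carrier SL"
  have "det P * det P' = 1" by (metis P_inv(1) det_I det_mul)
  then show ?thesis
    using SL.inv_closed[OF M] by (simp add: carrier_SL dual_def det_mul mult.commute det_transpose)
qed

lemma dual_mult:
  assumes "M \<in> carrier SL" "N \<in> carrier SL"
  shows "dual (M ** N) = dual M ** dual N"
proof (rule dual_eqI)
  show "M ** N \<in> carrier SL" using SL.m_closed[OF assms] by simp
  have "dual M ** dual N ** P ** transpose (M ** N) = dual M ** (dual N ** P ** transpose N) ** transpose M"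
    by (simp add: transpose_mult matrix_mul_assoc)
  then show "dual M ** dual N ** P ** transpose (M ** N) = P"
    by (simp add: dual_eq assms)
qed

text \<open>Transposing the defining equation interchanges \<open>M\<close> and
  \<open>dual M\<close>, because \<open>P\<close> is symmetric.\<close>

lemma dual_dual:
  assumes "M \<in> carrier SL"
  shows "dual (dual M) = M"
proof (rule dual_eqI)
  have "transpose (dual M ** P ** transpose M) = transpose P" by (simp add: dual_eq assms)
  then show "M ** P ** transpose (dual M) = P"
    by (simp add: transpose_mult transpose_P matrix_mul_assoc)
qed (simp add: assms)

lemma dual_hom: "dual \<in> hom SL SL"
  by (rule homI) (simp_all add: dual_mult)

interpretation dual: group_hom SL SL dual
  by (intro group_hom.intro group_SL group_hom_axioms.intro dual_hom)

lemma dual_A: "dual A = inv\<^bsub>SL\<^esub> C" and dual_B: "dual B = inv\<^bsub>SL\<^esub> B" and dual_C: "dual C = inv\<^bsub>SL\<^esub> A"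
proof -
  have 1: "P ** transpose A = C ** P" "P ** transpose B = B ** P"
    by (simp_all add: P_def A_def B_def C_def field_simps)
  show A: "dual A = inv\<^bsub>SL\<^esub> C"
    by (rule dual_eqI) (simp, metis ABC_SL(3) SL_inv_left 1(1) matrix_mul_assoc matrix_mul_lid)
  show "dual B = inv\<^bsub>SL\<^esub> B"
    by (rule dual_eqI) (simp, metis ABC_SL(2) SL_inv_left 1(2) matrix_mul_assoc matrix_mul_lid)
  have "inv\<^bsub>SL\<^esub> (dual C) = A" using A dual.hom_inv[of C] dual_dual[of A] by simp
  then show "dual C = inv\<^bsub>SL\<^esub> A" using SL.inv_inv[of "dual C"] by simp
qed

text \<open>Scalars go to scalars, which makes \<open>dual\<close> compatible with passing to
  \<open>PSL\<close>.\<close>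

lemma dual_mat:
  assumes "(mat k :: 'a^3^3) \<in> carrier SL"
  shows "dual (mat k) = mat (inverse k)"
proof (rule dual_eqI[OF assms])
  have "k \<noteq> 0" using assms by (auto simp: carrier_SL mat_eq_mat3)
  then show "mat (inverse k) ** P ** transpose (mat k) = P"
    by (simp add: P_def mat_eq_mat3)
qed

lemma generate_AB: "generate SL {A, B} = dual ` Stab"
proof -
  have "dual ` generate SL {B, C} = generate SL {inv\<^bsub>SL\<^esub> B, inv\<^bsub>SL\<^esub> A}"
    using dual.generate_img[of "{B, C}"] by (simp add: dual_B dual_C)
  then show ?thesis
    by (simp add: SL.generate_inv_pair insert_commute Stab_generate)
qed

definition psl_dual :: "('a^3^3) set \<Rightarrow> ('a^3^3) set" where
  "psl_dual U = dual ` U"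

text \<open>Inversion permutes the scalars of determinant one, so the elementwise image of a coset
  is a full coset.\<close>

lemma psl_dual_class:
  assumes M: "M \<in> carrier SL"
  shows "psl_dual (PSL_class M) = PSL_class (dual M)"
proof -
  have *: "(mat (inverse k) :: 'a^3^3) \<in> carrier SL \<and> dual (mat k ** M) = mat (inverse k) ** dual M"
    if "(mat k :: 'a^3^3) \<in> carrier SL" for k
    using that by (simp add: dual_mult M dual_mat) (metis dual_SL dual_mat)
  show ?thesis
  proof (intro equalityI subsetI)
    fix N assume "N \<in> psl_dual (PSL_class M)"
    then show "N \<in> PSL_class (dual M)" using * by (auto simp: psl_dual_def PSL_class_eq)
  next
    fix N assume "N \<in> PSL_class (dual M)"
    then obtain k where "(mat k :: 'a^3^3) \<in> carrier SL" "N = mat k ** dual M" by (auto simp: PSL_class_eq)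
    with *[of k] *[of "inverse k"] have "mat (inverse k) ** M \<in> PSL_class M" "N = dual (mat (inverse k) ** M)"
      by (auto simp: PSL_class_eq)
    then show "N \<in> psl_dual (PSL_class M)" by (auto simp: psl_dual_def)
  qed
qed

lemma psl_dual_psl_dual: "U \<in> carrier PSL \<Longrightarrow> psl_dual (psl_dual U) = U"
  by (erule PSL_cases) (simp add: psl_dual_class dual_dual)

lemma psl_dual_iso: "psl_dual \<in> iso PSL PSL"
proof (rule isoI)
  have c: "psl_dual U \<in> carrier PSL" if "U \<in> carrier PSL" for U
    using that by (elim PSL_cases) (auto simp: psl_dual_class carrier_PSL)
  show "psl_dual \<in> hom PSL PSL"
  proof (rule homI)
    fix U V :: "('a^3^3) set" assume "U \<in> carrier PSL" "V \<in> carrier PSL"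
    then obtain M N where "M \<in> carrier SL" "U = PSL_class M" "N \<in> carrier SL" "V = PSL_class N"
      by (auto elim!: PSL_cases)
    then show "psl_dual (U \<otimes>\<^bsub>PSL\<^esub> V) = psl_dual U \<otimes>\<^bsub>PSL\<^esub> psl_dual V"
      using SL.m_closed[of M N] by (simp add: PSL_class_mult psl_dual_class dual_mult)
  qed (rule c)
  show "bij_betw psl_dual (carrier PSL) (carrier PSL)"
    by (rule bij_betwI[of _ _ _ psl_dual]) (auto simp: c psl_dual_psl_dual)
qed

interpretation psl_dual: group_hom "PSL :: ('a^3^3) set monoid" PSL psl_dual
  using psl_dual_iso by (intro group_hom.intro group_PSL group_hom_axioms.intro) (simp add: iso_def)

section \<open>The generators in \<open>PSL\<close>, self-duality and the two rank three
  subgroups\<close>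

definition s1 :: "('a^3^3) set" where "s1 = PSL_class A"
definition s2 :: "('a^3^3) set" where "s2 = PSL_class B"
definition s3 :: "('a^3^3) set" where "s3 = PSL_class C"

lemma s_carrier [simp]: "s1 \<in> carrier PSL" "s2 \<in> carrier PSL" "s3 \<in> carrier PSL"
  by (simp_all add: s1_def s2_def s3_def)

lemma psl_dual_s: "psl_dual s1 = inv\<^bsub>PSL\<^esub> s3" "psl_dual s2 = inv\<^bsub>PSL\<^esub> s2" "psl_dual s3 = inv\<^bsub>PSL\<^esub> s1"
  by (simp_all add: s1_def s2_def s3_def psl_dual_class dual_A dual_B dual_C PSL_class.hom_inv)

lemma self_dual: "self_dual_rank4 PSL s1 s2 s3"
  unfolding self_dual_rank4_def using psl_dual_iso psl_dual_s by blast

lemma generate_s23: "generate PSL {s2, s3} = PSL_class ` Stab"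
  using PSL_class.generate_img[of "{B, C}"] by (simp add: Stab_generate s2_def s3_def)

lemma generate_s12: "generate PSL {s1, s2} = PSL_class ` dual ` Stab"
  using PSL_class.generate_img[of "{A, B}"] by (simp add: generate_AB s1_def s2_def)

lemma Stab_SL: "M \<in> Stab \<Longrightarrow> M \<in> carrier SL"
  by (simp add: Stab_def)

lemma mem_s23_iff: "M \<in> carrier SL \<Longrightarrow> PSL_class M \<in> generate PSL {s2, s3} \<longleftrightarrow> M \<in> Stab"
  unfolding generate_s23
  by (rule PSL_class_mem_iff[OF _ subgroup_Stab]) (auto simp: Stab_def SL_scalars_iff mat_eq_mat3)

lemma mem_dual_Stab_iff: "M \<in> carrier SL \<Longrightarrow> M \<in> dual ` Stab \<longleftrightarrow> dual M \<in> Stab"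
proof
  assume M: "M \<in> carrier SL" and "dual M \<in> Stab"
  then have "dual (dual M) \<in> dual ` Stab" by blast
  then show "M \<in> dual ` Stab" by (simp only: dual_dual[OF M])
qed (auto simp: dual_dual Stab_SL)

lemma mem_s12_iff: "M \<in> carrier SL \<Longrightarrow> PSL_class M \<in> generate PSL {s1, s2} \<longleftrightarrow> dual M \<in> Stab"
proof -
  assume M: "M \<in> carrier SL"
  have "PSL_class M \<in> generate PSL {s1, s2} \<longleftrightarrow> M \<in> dual ` Stab"
    unfolding generate_s12
  proof (rule PSL_class_mem_iff[OF M])
    show "subgroup (dual ` Stab) SL"
      using SL.generate_is_subgroup[of "{A, B}"] by (simp add: generate_AB)
    show "SL_scalars \<subseteq> dual ` Stab"
    proof
      fix N :: "'a^3^3" assume "N \<in> SL_scalars"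
      then obtain k where N: "N = mat k" and k: "(mat k :: 'a^3^3) \<in> carrier SL"
        by (auto simp: SL_scalars_iff)
      have "(mat (inverse k) :: 'a^3^3) \<in> carrier SL"
        using dual_SL[OF k] by (simp only: dual_mat[OF k])
      then have "dual N \<in> Stab"
        by (auto simp: N dual_mat[OF k] Stab_def) (auto simp: mat_eq_mat3)
      then show "N \<in> dual ` Stab" using dual_dual[OF k] N by (metis imageI)
    qed
  qed
  also have "\<dots> \<longleftrightarrow> dual M \<in> Stab" by (rule mem_dual_Stab_iff[OF M])
  finally show ?thesis .
qed


section \<open>Stabilisers of points and lines\<close>

text \<open>The factor may be zero; for the image of a nonzero vector under a matrix in
  \<open>SL\<close> it cannot be, and the relation then means equality of spans.\<close>

definition is_scale :: "'a^3 \<Rightarrow> 'a^3 \<Rightarrow> bool" where "is_scale v w \<longleftrightarrow> (\<exists>k. v = k *s w)"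

lemma is_scale_E2 [simp]: "k \<noteq> 0 \<Longrightarrow> is_scale (vector [a, b, c]) (vector [0, k, 0]) \<longleftrightarrow> a = 0 \<and> c = 0"
  and is_scale_E3 [simp]: "k \<noteq> 0 \<Longrightarrow> is_scale (vector [a, b, c]) (vector [0, 0, k]) \<longleftrightarrow> a = 0 \<and> b = 0"
  by (auto simp: is_scale_def intro: exI[of _ "b / k"] exI[of _ "c / k"])

text \<open>Arbitrary nonzero multiples of e2 and e3 are allowed because the criterion is applied
  both to these vectors and to the images under \<open>P\<close> of two linear forms.\<close>

lemma Stab_iff_is_scale:
  assumes M: "M \<in> carrier SL" and k: "k \<noteq> 0" "l \<noteq> 0"
  defines "u \<equiv> vector [0, k, 0]" and "w \<equiv> vector [0, 0, l]"
  shows "M \<in> Stab \<longleftrightarrow> is_scale (M *v u) u \<and> is_scale (M *v w) w \<or> is_scale (M *v u) w \<and> is_scale (M *v w) u"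
  using M k by (cases M rule: mat3_cases) (auto simp: Stab_def u_def w_def)

lemma SL_inv_vec: "M \<in> carrier SL \<Longrightarrow> inv\<^bsub>SL\<^esub> M *v (M *v v) = v" "M \<in> carrier SL \<Longrightarrow> M *v (inv\<^bsub>SL\<^esub> M *v v) = v"
  by (simp_all add: matrix_vector_mul_assoc SL_inv_left SL_inv_right)

lemma image_span_singleton_eq_iff:
  assumes M: "M \<in> carrier SL" and "v \<noteq> 0"
  shows "(*v) M ` vec.span {v} = vec.span {w} \<longleftrightarrow> is_scale (M *v v) w"
proof
  have v: "M *v v \<in> (*v) M ` vec.span {v}" by (simp add: vec.span_base)
  assume "(*v) M ` vec.span {v} = vec.span {w}"
  with v have "M *v v \<in> vec.span {w}" by simp
  then show "is_scale (M *v v) w" by (auto simp: vec.span_singleton is_scale_def)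
next
  assume "is_scale (M *v v) w"
  then obtain k where k: "M *v v = k *s w" by (auto simp: is_scale_def)
  have "M *v v \<noteq> 0" using SL_inv_vec(1)[OF M, of v] assms(2) by auto
  with k have nz: "k \<noteq> 0" by auto
  have *: "M *v (c *s v) = (c * k) *s w" for c
    by (simp only: vector_scalar_commute k vector_smult_assoc)
  show "(*v) M ` vec.span {v} = vec.span {w}"
    unfolding vec.span_singleton
  proof (intro equalityI subsetI)
    fix y assume "y \<in> range (\<lambda>k. k *s w)"
    then obtain c where "y = M *v ((c / k) *s v)" using nz by (auto simp: *)
    then show "y \<in> (*v) M ` range (\<lambda>k. k *s v)" by auto
  qed (auto simp: *)
qed

definition point2 :: "('a^3) set" where "point2 = vec.span {vector [0, 1, 0]}"
definition point3 :: "('a^3) set" where "point3 = vec.span {vector [0, 0, 1]}"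

lemma vector_zero: "(0 :: 'a^3) = vector [0, 0, 0]"
  by (simp add: vec_eq_iff forall_3)

lemma points: "point2 \<in> proj_points" "point3 \<in> proj_points" "point2 \<noteq> point3"
proof -
  have *: "vec.span {v} \<in> proj_points" if "v \<noteq> 0" for v :: "'a^3"
    using that vec.dim_eq_card_independent[of "{v}"] by (simp add: proj_points_def)
  show "point2 \<in> proj_points" "point3 \<in> proj_points"
    unfolding point2_def point3_def by (rule *, simp add: vector_zero)+
  have "vector [0, 1, 0] \<in> point2" by (simp add: point2_def vec.span_base)
  moreover have "vector [0, 1, 0] \<notin> point3" by (auto simp: point3_def vec.span_singleton)
  ultimately show "point2 \<noteq> point3" by metis
qed

lemma PSL_stabiliser_pair:
  assumes M: "M \<in> carrier SL" and "vec.subspace U" "vec.subspace V" "U \<noteq> (V :: ('a^3) set)"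
  shows "PSL_class M \<in> PSL_setwise_stabiliser {U, V} \<longleftrightarrow>
    (*v) M ` U = U \<and> (*v) M ` V = V \<or> (*v) M ` U = V \<and> (*v) M ` V = U"
  using assms by (auto simp: PSL_setwise_stabiliser_def PSL_act_class doubleton_eq_iff)

lemma generate_s23_stabiliser: "generate PSL {s2, s3} = PSL_setwise_stabiliser {point2, point3}"
proof -
  have sub: "vec.subspace point2" "vec.subspace point3" by (simp_all add: point2_def point3_def)
  have "PSL_class M \<in> generate PSL {s2, s3} \<longleftrightarrow> PSL_class M \<in> PSL_setwise_stabiliser {point2, point3}"
    if M: "M \<in> carrier SL" for M
    unfolding mem_s23_iff[OF M] Stab_iff_is_scale[OF M zero_neq_one[symmetric] zero_neq_one[symmetric]]
      PSL_stabiliser_pair[OF M sub points(3)]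
    unfolding point2_def point3_def
    by (subst (1 2 3 4) image_span_singleton_eq_iff[OF M]) (auto simp: vector_zero)
  moreover have "generate PSL {s2, s3} \<subseteq> carrier PSL" by (rule PSL.generate_incl) simp
  moreover have "PSL_setwise_stabiliser {point2, point3} \<subseteq> carrier PSL"
    by (auto simp: PSL_setwise_stabiliser_def)
  ultimately show ?thesis by (auto elim!: PSL_cases)
qed

section \<open>Lines as kernels of linear forms\<close>

definition dotp :: "'a^3 \<Rightarrow> 'a^3 \<Rightarrow> 'a" where
  "dotp f v = f $ 1 * v $ 1 + f $ 2 * v $ 2 + f $ 3 * v $ 3"

definition ker :: "'a^3 \<Rightarrow> ('a^3) set" where "ker f = {v. dotp f v = 0}"

lemma dotp_mult_vector: "dotp f (N *v v) = dotp (f v* N) v"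
  unfolding transpose_matrix_vector[symmetric]
  by (cases N rule: mat3_cases, cases f rule: vec3_cases, cases v rule: vec3_cases)
    (simp add: dotp_def algebra_simps del: transpose_matrix_vector)

lemma image_ker:
  assumes M: "M \<in> carrier SL"
  shows "(*v) M ` ker f = ker (f v* inv\<^bsub>SL\<^esub> M)"
proof (intro equalityI subsetI)
  fix w assume "w \<in> ker (f v* inv\<^bsub>SL\<^esub> M)"
  then have "inv\<^bsub>SL\<^esub> M *v w \<in> ker f" by (simp add: ker_def dotp_mult_vector)
  then show "w \<in> (*v) M ` ker f" using SL_inv_vec(2)[OF M, of w] by (metis imageI)
qed (auto simp: ker_def SL_inv_vec[OF M] dotp_mult_vector[symmetric])

text \<open>The vectors (1, 0, 0) and (0, 1, k) lie in the kernel on the right, and a form vanishing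
  on both is determined up to a factor.\<close>

lemma ker_eq_iff:
  assumes "k \<noteq> 0" "f \<noteq> 0"
  shows "ker f = ker (vector [0, 1, - inverse k]) \<longleftrightarrow> is_scale f (vector [0, 1, - inverse k])"
proof
  assume *: "ker f = ker (vector [0, 1, - inverse k])"
  have "vector [1, 0, 0] \<in> ker (vector [0, 1, - inverse k])"
    "vector [0, 1, k] \<in> ker (vector [0, 1, - inverse k])"
    using assms by (simp_all add: ker_def dotp_def)
  then have "vector [1, 0, 0] \<in> ker f" "vector [0, 1, k] \<in> ker f" using * by auto
  then have "f $ 1 = 0" "f $ 2 + f $ 3 * k = 0" by (simp_all add: ker_def dotp_def)
  then have "f = f $ 2 *s vector [0, 1, - inverse k]"
    using assms by (simp add: vec_eq_iff forall_3 field_simps eq_neg_iff_add_eq_0)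
  then show "is_scale f (vector [0, 1, - inverse k])" by (auto simp: is_scale_def)
next
  assume "is_scale f (vector [0, 1, - inverse k])"
  then obtain c where c: "f = c *s vector [0, 1, - inverse k]" by (auto simp: is_scale_def)
  with assms have "c \<noteq> 0" by (auto simp: vector_zero)
  then have "dotp f v = 0 \<longleftrightarrow> dotp (vector [0, 1, - inverse k]) v = 0" for v
    by (simp add: c dotp_def mult.assoc flip: right_diff_distrib)
  then show "ker f = ker (vector [0, 1, - inverse k])" by (auto simp: ker_def)
qed

text \<open>\<open>P\<close> maps \<open>f1\<close> and \<open>f2\<close> to multiples of e3 and e2,
  so their kernels are the lines dual to the two points. Writing \<open>inverse 1\<close> gives both
  forms the shape used in \<open>ker_eq_iff\<close>.\<close>

definition f1 :: "'a^3" where "f1 = vector [0, 1, - inverse 1]"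
definition f2 :: "'a^3" where "f2 = vector [0, 1, - inverse x]"

lemma lines: "ker f1 \<in> proj_lines" "ker f2 \<in> proj_lines" "ker f1 \<noteq> ker f2"
proof -
  have *: "ker (vector [0, 1, - inverse k]) \<in> proj_lines" if k: "k \<noteq> 0" for k
  proof -
    let ?B = "{vector [1, 0, 0], vector [0, 1, k]} :: ('a^3) set"
    have "vec.independent ?B"
      by (auto simp: vec.independent_insert vec.span_singleton vector_zero)
    then have "vec.dim (vec.span ?B) = 2"
      by (simp add: vec.dim_eq_card_independent)
    moreover have "vec.span ?B = ker (vector [0, 1, - inverse k])"
    proof -
      have "v \<in> vec.span ?B \<longleftrightarrow> v \<in> ker (vector [0, 1, - inverse k])" for v
      proof (cases v rule: vec3_cases)
        case (1 a b c)
        have "v - l *s vector [1, 0, 0] = vector [a - l, b, c]" for l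
          by (simp add: 1 vec_eq_iff forall_3)
        then show ?thesis using k
          by (auto simp: vec.span_insert vec.span_singleton ker_def dotp_def 1 field_simps)
      qed
      then show ?thesis by blast
    qed
    ultimately show ?thesis unfolding proj_lines_def by (metis (mono_tags) mem_Collect_eq vec.subspace_span)
  qed
  show "ker f1 \<in> proj_lines" "ker f2 \<in> proj_lines"
    unfolding f1_def f2_def by (rule *; simp)+
  have "vector [0, 1, 1] \<in> ker f1" "vector [0, 1, 1] \<notin> ker f2"
    by (auto simp: f1_def f2_def ker_def dotp_def inverse_eq_1_iff)
  then show "ker f1 \<noteq> ker f2" by metis
qed

text \<open>\<open>P\<close> intertwines the action of \<open>M\<close> on linear forms with the
  action of \<open>dual M\<close> on vectors.\<close>

lemma is_scale_dual_iff:
  assumes M: "M \<in> carrier SL"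
  shows "is_scale (f v* inv\<^bsub>SL\<^esub> M) f' \<longleftrightarrow> is_scale (dual M *v (P *v f)) (P *v f')"
proof -
  have 1: "dual M *v (P *v f) = P *v (f v* inv\<^bsub>SL\<^esub> M)"
    unfolding dual_def transpose_matrix_vector[symmetric]
    by (metis P_inv(2) matrix_mul_assoc matrix_mul_rid matrix_vector_mul_assoc)
  have 2: "P *v u = P *v w \<longleftrightarrow> u = w" for u w
    by (metis P_inv(2) matrix_vector_mul_assoc matrix_vector_mul_lid)
  have 3: "k *s (P *v f') = P *v (k *s f')" for k by (simp add: vector_scalar_commute)
  show ?thesis by (simp only: is_scale_def 1 2 3)
qed

lemma generate_s12_stabiliser: "generate PSL {s1, s2} = PSL_setwise_stabiliser {ker f1, ker f2}"
proof -
  have sub: "vec.subspace (ker f1)" "vec.subspace (ker f2)"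
    using lines by (simp_all add: proj_lines_def)
  have Pf: "P *v f1 = vector [0, 0, 1 - x]" "P *v f2 = vector [0, 1 - inverse x, 0]"
    by (simp_all add: P_def f1_def f2_def)
  have nz: "1 - x \<noteq> 0" "1 - inverse x \<noteq> 0" using x_neq(1) by (auto simp: inverse_eq_1_iff)
  have "PSL_class M \<in> generate PSL {s1, s2} \<longleftrightarrow> PSL_class M \<in> PSL_setwise_stabiliser {ker f1, ker f2}"
    if M: "M \<in> carrier SL" for M
  proof -
    have "f v* inv\<^bsub>SL\<^esub> M \<noteq> 0" if "f \<noteq> 0" for f
    proof -
      have "transpose M ** transpose (inv\<^bsub>SL\<^esub> M) = mat 1"
        using SL_inv_left[OF M] by (metis transpose_mat transpose_mult)
      then show ?thesis
        using that unfolding transpose_matrix_vector[symmetric]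
        by (metis matrix_vector_mul_assoc matrix_vector_mul_lid matrix_vector_mult_0_right)
    qed
    note nonzero = this
    have *: "(*v) M ` ker f = ker f' \<longleftrightarrow> is_scale (dual M *v (P *v f)) (P *v f')"
      if ff: "f \<in> {f1, f2}" "f' \<in> {f1, f2}" for f f'
    proof -
      have "f \<noteq> 0" using ff by (auto simp: f1_def f2_def vector_zero)
      obtain k where k: "k \<noteq> 0" and f': "f' = vector [0, 1, - inverse k]"
        using ff(2) x_nz that[of 1] that[of x] by (auto simp: f1_def f2_def)
      show ?thesis
        unfolding is_scale_dual_iff[OF M, symmetric] image_ker[OF M] f'
        by (rule ker_eq_iff[OF k nonzero[OF \<open>f \<noteq> 0\<close>]])
    qed
    have "PSL_class M \<in> PSL_setwise_stabiliser {ker f1, ker f2} \<longleftrightarrow>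
        is_scale (dual M *v (P *v f1)) (P *v f1) \<and> is_scale (dual M *v (P *v f2)) (P *v f2) \<or>
        is_scale (dual M *v (P *v f1)) (P *v f2) \<and> is_scale (dual M *v (P *v f2)) (P *v f1)"
      unfolding PSL_stabiliser_pair[OF M sub lines(3)] by (simp only: * insert_iff simp_thms)
    \<comment> \<open>The vector along e2 comes from \<open>f2\<close> and the one along e3 from
      \<open>f1\<close>, hence the order \<open>nz(2)\<close>, \<open>nz(1)\<close>.\<close>
    then show ?thesis
      unfolding mem_s12_iff[OF M] Stab_iff_is_scale[OF dual_SL[OF M] nz(2) nz(1)] Pf by blast
  qed
  moreover have "generate PSL {s1, s2} \<subseteq> carrier PSL" by (rule PSL.generate_incl) simp
  moreover have "PSL_setwise_stabiliser {ker f1, ker f2} \<subseteq> carrier PSL"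
    by (auto simp: PSL_setwise_stabiliser_def)
  ultimately show ?thesis by (auto elim!: PSL_cases)
qed


section \<open>Orders of the generators\<close>

text \<open>The closed form gives the order, since the middle diagonal entry is 1, and its (2,1)
  entry is what separates powers of \<open>C\<close> from the dual stabiliser.\<close>

lemma C_power:
  "C [^]\<^bsub>SL\<^esub> n = mat3 (x ^ n) 0 0  ((1 + inverse x) * (x ^ n - 1)) 1 0  (x ^ n - inverse (x ^ n)) 0 (inverse (x ^ n))"
  for n :: nat
proof (induction n)
  case 0
  then show ?case by (simp add: mat_eq_mat3)
next
  case (Suc n)
  then show ?case by (simp add: C_def) (simp add: field_simps)
qed

lemma s3_power: "s3 [^]\<^bsub>PSL\<^esub> n = PSL_class (C [^]\<^bsub>SL\<^esub> n)" for n :: nat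
  using PSL_class.hom_nat_pow[of C n] by (simp add: s3_def)

lemma C_power_SL: "C [^]\<^bsub>SL\<^esub> n \<in> carrier SL" for n :: nat
  using SL.nat_pow_closed[of C n] by simp

lemma s3_power_eq_one_iff: "s3 [^]\<^bsub>PSL\<^esub> n = \<one>\<^bsub>PSL\<^esub> \<longleftrightarrow> x ^ n = 1" for n :: nat
proof -
  have "(\<exists>k. C [^]\<^bsub>SL\<^esub> n = mat k) \<longleftrightarrow> x ^ n = 1"
    by (auto simp: C_power mat_eq_mat3)
  then show ?thesis unfolding s3_power using PSL_class_eq_one_iff[OF C_power_SL] by metis
qed

lemma ord_s3: "PSL.ord s3 = CARD('a) - 1"
  using PSL.ord_unique[of s3 "CARD('a) - 1"] by (simp add: s3_power_eq_one_iff power_eq_one_iff)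

lemma psl_dual_eq_one_iff: "U \<in> carrier PSL \<Longrightarrow> psl_dual U = \<one>\<^bsub>PSL\<^esub> \<longleftrightarrow> U = \<one>\<^bsub>PSL\<^esub>"
  by (metis psl_dual.hom_one psl_dual_psl_dual)

lemma psl_dual_s1_power: "psl_dual (s1 [^]\<^bsub>PSL\<^esub> n) = inv\<^bsub>PSL\<^esub> (s3 [^]\<^bsub>PSL\<^esub> n)" for n :: nat
  using psl_dual.hom_nat_pow[of s1 n] by (simp add: psl_dual_s PSL.nat_pow_inv)

lemma s1_power_eq_one_iff: "s1 [^]\<^bsub>PSL\<^esub> n = \<one>\<^bsub>PSL\<^esub> \<longleftrightarrow> x ^ n = 1" for n :: nat
  by (metis PSL.inv_eq_1_iff PSL.nat_pow_closed psl_dual_eq_one_iff psl_dual_s1_power s3_power_eq_one_iff s_carrier(1,3))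

lemma ord_s1: "PSL.ord s1 = CARD('a) - 1"
  using PSL.ord_unique[of s1 "CARD('a) - 1"] by (simp add: s1_power_eq_one_iff power_eq_one_iff)

lemma B_power_even:
  "B [^]\<^bsub>SL\<^esub> (2 * n) = mat3 (inverse (x ^ n * x ^ n)) 0 0  0 (x ^ n) 0  0 0 (x ^ n)" for n :: nat
proof (induction n)
  case 0
  then show ?case by (simp add: mat_eq_mat3)
next
  case (Suc n)
  have "B [^]\<^bsub>SL\<^esub> (2 * Suc n) = B [^]\<^bsub>SL\<^esub> (2 * n) ** B ** B" by simp
  then show ?case by (simp only: Suc.IH) (simp add: B_def field_simps)
qed

text \<open>Odd powers of \<open>B\<close> still exchange e2 and e3 up to factors. An even power is
  diagonal, and with \<open>m = n div 2\<close> it is scalar exactly when the inverse square of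
  \<open>x ^ m\<close> equals \<open>x ^ m\<close>.\<close>

lemma s2_power_eq_one_iff:
  "s2 [^]\<^bsub>PSL\<^esub> n = \<one>\<^bsub>PSL\<^esub> \<longleftrightarrow> even n \<and> x ^ (3 * (n div 2)) = 1" for n :: nat
proof -
  have SL: "B [^]\<^bsub>SL\<^esub> n \<in> carrier SL" using SL.nat_pow_closed[of B n] by simp
  have "s2 [^]\<^bsub>PSL\<^esub> n = PSL_class (B [^]\<^bsub>SL\<^esub> n)"
    using PSL_class.hom_nat_pow[of B n] by (simp add: s2_def)
  then have iff: "s2 [^]\<^bsub>PSL\<^esub> n = \<one>\<^bsub>PSL\<^esub> \<longleftrightarrow> (\<exists>k. B [^]\<^bsub>SL\<^esub> n = mat k)"
    using PSL_class_eq_one_iff[OF SL] by simp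
  show ?thesis
  proof (cases "even n")
    case True
    then obtain m where m: "n = 2 * m" by auto
    have "x ^ (3 * m) = x ^ m * x ^ m * x ^ m" by (simp add: power_mult power3_eq_cube mult.commute[of 3])
    moreover have "inverse (x ^ m * x ^ m) = x ^ m \<longleftrightarrow> x ^ m * x ^ m * x ^ m = 1"
      by (auto simp: field_simps)
    moreover have "(\<exists>k. B [^]\<^bsub>SL\<^esub> n = mat k) \<longleftrightarrow> inverse (x ^ m * x ^ m) = x ^ m"
      by (simp add: m B_power_even mat_eq_mat3 del: inverse_mult_distrib) auto
    ultimately show ?thesis using iff True m by simp
  next
    case False
    then obtain m where m: "n = Suc (2 * m)" by (auto elim: oddE)
    have "B [^]\<^bsub>SL\<^esub> n = B [^]\<^bsub>SL\<^esub> (2 * m) ** B" by (simp add: m)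
    then have "\<not> (\<exists>k. B [^]\<^bsub>SL\<^esub> n = mat k)"
      by (simp only: B_power_even) (simp add: B_def mat_eq_mat3)
    then show ?thesis using iff False by simp
  qed
qed

lemma dvd_three_mult_iff: "m dvd 3 * n \<longleftrightarrow> m div gcd 3 m dvd n" for m n :: nat
proof (cases "3 dvd m")
  case True
  then obtain k where "m = 3 * k" by auto
  then show ?thesis by simp
next
  case False
  then have "coprime 3 m" by (intro prime_imp_coprime) auto
  then have "coprime m 3" and "gcd 3 m = 1" by (simp_all add: coprime_commute)
  then show ?thesis by (simp add: coprime_dvd_mult_right_iff)
qed

lemma ord_s2: "PSL.ord s2 = 2 * (CARD('a) - 1) div gcd 3 (CARD('a) - 1)"
proof -
  let ?m = "CARD('a) - 1"
  have "2 * ?m div gcd 3 ?m = 2 * (?m div gcd 3 ?m)" by (simp add: div_mult_swap)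
  moreover have "s2 [^]\<^bsub>PSL\<^esub> n = \<one>\<^bsub>PSL\<^esub> \<longleftrightarrow> 2 * (?m div gcd 3 ?m) dvd n" for n :: nat
  proof (cases "even n")
    case True
    then obtain k where "n = 2 * k" by auto
    then show ?thesis by (simp add: s2_power_eq_one_iff power_eq_one_iff dvd_three_mult_iff)
  next
    case False
    then show ?thesis by (auto simp: s2_power_eq_one_iff dest: dvd_mult_left)
  qed
  ultimately show ?thesis using PSL.ord_unique[of s2] by simp
qed

section \<open>The three involutions of the string property\<close>

lemma AB_eq: "A ** B = mat3 (- 1) 0 1  0 (- 1) (1 + inverse x)  0 0 1"
  and BC_eq: "B ** C = mat3 (- 1) 0 0  (x - inverse x) 0 (inverse x)  (x * x - 1) x 0"
  and ABC_eq: "A ** (B ** C) = mat3 (- inverse x) 0 (inverse x)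
    (1 - inverse x * inverse x) (- 1) ((1 + inverse x) * inverse x)  (x - inverse x) 0 (inverse x)"
  by (simp_all add: A_def B_def C_def) (simp_all add: field_simps)

lemma PSL_involution:
  fixes M :: "'a^3^3"
  assumes "M \<in> carrier SL" "M ** M = mat 1" "\<And>k. M \<noteq> mat k"
  shows "PSL_class M \<otimes>\<^bsub>PSL\<^esub> PSL_class M = \<one>\<^bsub>PSL\<^esub>" "PSL_class M \<noteq> \<one>\<^bsub>PSL\<^esub>"
proof -
  have "PSL_class (mat 1 :: 'a^3^3) = \<one>\<^bsub>PSL\<^esub>" using PSL_class.hom_one by simp
  then show "PSL_class M \<otimes>\<^bsub>PSL\<^esub> PSL_class M = \<one>\<^bsub>PSL\<^esub>" using assms by (simp add: PSL_class_mult)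
  show "PSL_class M \<noteq> \<one>\<^bsub>PSL\<^esub>" using assms by (simp add: PSL_class_eq_one_iff)
qed

lemma prod_SL: "A ** B \<in> carrier SL" "B ** C \<in> carrier SL" "A ** (B ** C) \<in> carrier SL"
  using SL.m_closed[of A B] SL.m_closed[of B C] SL.m_closed[of A "B ** C"] by simp_all

lemma s_prod: "s1 \<otimes>\<^bsub>PSL\<^esub> s2 = PSL_class (A ** B)" "s2 \<otimes>\<^bsub>PSL\<^esub> s3 = PSL_class (B ** C)"
  "s1 \<otimes>\<^bsub>PSL\<^esub> (s2 \<otimes>\<^bsub>PSL\<^esub> s3) = PSL_class (A ** (B ** C))"
  by (simp_all add: s1_def s2_def s3_def PSL_class_mult prod_SL)

lemma involutions:
  shows "(s1 \<otimes>\<^bsub>PSL\<^esub> s2) \<otimes>\<^bsub>PSL\<^esub> (s1 \<otimes>\<^bsub>PSL\<^esub> s2) = \<one>\<^bsub>PSL\<^esub>" "s1 \<otimes>\<^bsub>PSL\<^esub> s2 \<noteq> \<one>\<^bsub>PSL\<^esub>"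
    "(s2 \<otimes>\<^bsub>PSL\<^esub> s3) \<otimes>\<^bsub>PSL\<^esub> (s2 \<otimes>\<^bsub>PSL\<^esub> s3) = \<one>\<^bsub>PSL\<^esub>" "s2 \<otimes>\<^bsub>PSL\<^esub> s3 \<noteq> \<one>\<^bsub>PSL\<^esub>"
    "(s1 \<otimes>\<^bsub>PSL\<^esub> (s2 \<otimes>\<^bsub>PSL\<^esub> s3)) \<otimes>\<^bsub>PSL\<^esub> (s1 \<otimes>\<^bsub>PSL\<^esub> (s2 \<otimes>\<^bsub>PSL\<^esub> s3)) = \<one>\<^bsub>PSL\<^esub>"
    "s1 \<otimes>\<^bsub>PSL\<^esub> (s2 \<otimes>\<^bsub>PSL\<^esub> s3) \<noteq> \<one>\<^bsub>PSL\<^esub>"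
proof -
  have sq: "(A ** B) ** (A ** B) = mat 1" "(B ** C) ** (B ** C) = mat 1"
    "(A ** (B ** C)) ** (A ** (B ** C)) = mat 1"
    unfolding ABC_eq unfolding AB_eq BC_eq mat_eq_mat3 by (simp_all add: field_simps)
  have nt: "A ** B \<noteq> mat k" "B ** C \<noteq> mat k" "A ** (B ** C) \<noteq> mat k" for k
    unfolding ABC_eq unfolding AB_eq BC_eq mat_eq_mat3 by simp_all
  show "(s1 \<otimes>\<^bsub>PSL\<^esub> s2) \<otimes>\<^bsub>PSL\<^esub> (s1 \<otimes>\<^bsub>PSL\<^esub> s2) = \<one>\<^bsub>PSL\<^esub>" "s1 \<otimes>\<^bsub>PSL\<^esub> s2 \<noteq> \<one>\<^bsub>PSL\<^esub>"
    "(s2 \<otimes>\<^bsub>PSL\<^esub> s3) \<otimes>\<^bsub>PSL\<^esub> (s2 \<otimes>\<^bsub>PSL\<^esub> s3) = \<one>\<^bsub>PSL\<^esub>" "s2 \<otimes>\<^bsub>PSL\<^esub> s3 \<noteq> \<one>\<^bsub>PSL\<^esub>"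
    "(s1 \<otimes>\<^bsub>PSL\<^esub> (s2 \<otimes>\<^bsub>PSL\<^esub> s3)) \<otimes>\<^bsub>PSL\<^esub> (s1 \<otimes>\<^bsub>PSL\<^esub> (s2 \<otimes>\<^bsub>PSL\<^esub> s3)) = \<one>\<^bsub>PSL\<^esub>"
    "s1 \<otimes>\<^bsub>PSL\<^esub> (s2 \<otimes>\<^bsub>PSL\<^esub> s3) \<noteq> \<one>\<^bsub>PSL\<^esub>"
    unfolding s_prod(3) unfolding s_prod(1,2)
    by (rule PSL_involution[OF prod_SL(1) sq(1) nt(1)] PSL_involution[OF prod_SL(2) sq(2) nt(2)]
        PSL_involution[OF prod_SL(3) sq(3) nt(3)])+
qed

lemma s_nontrivial: "s1 \<noteq> \<one>\<^bsub>PSL\<^esub>" "s2 \<noteq> \<one>\<^bsub>PSL\<^esub>" "s3 \<noteq> \<one>\<^bsub>PSL\<^esub>"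
  using s1_power_eq_one_iff[of 1] s2_power_eq_one_iff[of 1] s3_power_eq_one_iff[of 1] by auto

lemma string: "string_property PSL 4 [s1, s2, s3]"
proof -
  have "PSL.ord (tau PSL [s1, s2, s3] i j) = 2" if "1 \<le> i" "i < j" "j \<le> 3" for i j
  proof -
    have "i = Suc 0 \<and> j = 2 \<or> i = 2 \<and> j = 3 \<or> i = Suc 0 \<and> j = 3" using that by linarith
    then show ?thesis
      by (elim disjE conjE) (simp_all add: PSL.tau_rank4 PSL.ord_eq_twoI involutions)
  qed
  then show ?thesis by (simp add: string_property_def)
qed


section \<open>Generation of the whole group\<close>

text \<open>These are the elations with centre spanned by e1; duality turns them into the elations
  with axis spanned by e2 and e3.\<close>

lemma row_elation_mem: "mat3 1 b c 0 1 0 0 0 1 \<in> dual ` Stab"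
proof -
  have SL: "mat3 1 b c 0 1 0 0 0 1 \<in> carrier SL" by (simp add: carrier_SL)
  have "dual (mat3 1 b c 0 1 0 0 0 1) =
      L 1 (- (b + c) * (x - inverse x)) 1 (- (b + x * c) * (x - inverse x)) 1"
  proof (rule dual_eqI[OF SL])
    show "L 1 (- (b + c) * (x - inverse x)) 1 (- (b + x * c) * (x - inverse x)) 1 ** P **
        transpose (mat3 1 b c 0 1 0 0 0 1) = P"
      by (simp add: P_def mult.assoc)
  qed
  then show ?thesis using mem_dual_Stab_iff[OF SL] by (simp add: L_Stab)
qed

text \<open>Gaussian elimination: the elations in the two subgroups supply row and column
  operations, and \<open>Stab\<close> supplies the diagonal matrices.\<close>

lemma generate_ABC: "generate SL {A, B, C} = carrier SL"
proof
  let ?H = "generate SL {A, B, C}"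
  show "?H \<subseteq> carrier SL" by (rule SL.generate_incl) simp
  have H: "subgroup ?H SL" by (rule SL.generate_is_subgroup) simp
  have mult: "M ** N \<in> ?H" if "M \<in> ?H" "N \<in> ?H" for M N
    using subgroup.m_closed[OF H that] by simp
  have Stab: "M \<in> ?H" if "M \<in> Stab" for M
    using SL.mono_generate[of "{B, C}" "{A, B, C}"] that by (auto simp: Stab_generate)
  have R: "mat3 1 b c 0 1 0 0 0 1 \<in> ?H" for b c
    using SL.mono_generate[of "{A, B}" "{A, B, C}"] row_elation_mem by (auto simp: generate_AB)
  have N: "L 1 b 1 d 1 \<in> ?H" for b d by (rule Stab) (simp add: L_Stab)
  \<comment> \<open>The two missing kinds of transvection are commutators of a column elation and a
    row elation.\<close>
  have E23: "mat3 1 0 0 0 1 s 0 0 1 \<in> ?H" and E32: "mat3 1 0 0 0 1 0 0 s 1 \<in> ?H" for s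
  proof -
    have "mat3 1 0 0 0 1 s 0 0 1 = L 1 1 1 0 1 ** mat3 1 0 s 0 1 0 0 0 1 **
        L 1 (- 1) 1 0 1 ** mat3 1 0 (- s) 0 1 0 0 0 1"
      "mat3 1 0 0 0 1 0 0 s 1 = L 1 0 1 1 1 ** mat3 1 s 0 0 1 0 0 0 1 **
        L 1 0 1 (- 1) 1 ** mat3 1 (- s) 0 0 1 0 0 0 1"
      by simp_all
    then show "mat3 1 0 0 0 1 s 0 0 1 \<in> ?H" "mat3 1 0 0 0 1 0 0 s 1 \<in> ?H"
      using mult N R by metis+
  qed
  \<comment> \<open>Triangular factorisation of the lower block with pivot \<open>e\<close>. In
    \<open>block\<close>, a zero pivot is repaired by adding the third row to the second.\<close>
  have block1: "mat3 a 0 0 0 e f 0 h i \<in> ?H" if "a * (e * i - f * h) = 1" "e \<noteq> 0" for a e f h i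
  proof -
    have "mat3 a 0 0 0 e f 0 h i =
        mat3 1 0 0 0 1 0 0 (h / e) 1 ** L a 0 e 0 (i - h * f / e) ** mat3 1 0 0 0 1 (f / e) 0 0 1"
      using that(2) by simp
    moreover have "e * (i - h * f / e) = e * i - f * h"
      using that(2) by (simp add: right_diff_distrib mult.commute)
    then have "L a 0 e 0 (i - h * f / e) \<in> ?H"
      using that(1) by (intro Stab) (simp add: L_Stab mult.assoc)
    ultimately show ?thesis using mult E23 E32 by metis
  qed
  have block: "mat3 a 0 0 0 e f 0 h i \<in> ?H" if d: "a * (e * i - f * h) = 1" for a e f h i
  proof (cases "e = 0")
    case True
    with d have "h \<noteq> 0" by auto
    then have "mat3 a 0 0 0 h (f + i) 0 h i \<in> ?H"
      using d True by (intro block1) (simp_all add: algebra_simps)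
    moreover have "mat3 a 0 0 0 e f 0 h i = mat3 1 0 0 0 1 (- 1) 0 0 1 ** mat3 a 0 0 0 h (f + i) 0 h i"
      using True by simp
    ultimately show ?thesis using mult E23 by metis
  qed (use d block1 in blast)
  have corner: "M \<in> ?H" if M: "M = mat3 a b c d e f g h i" "M \<in> carrier SL" "a \<noteq> 0" for M a b c d e f g h i
  proof -
    \<comment> \<open>The Schur complement of the corner \<open>a\<close>: clearing the first row
      and column leaves a block matrix.\<close>
    define e' f' h' i' where ds: "e' = e - d * b / a" "f' = f - d * c / a" "h' = h - g * b / a" "i' = i - g * c / a"
    define K where "K = mat3 a 0 0 0 e' f' 0 h' i'"
    have MK: "M = L 1 (d / a) 1 (g / a) 1 ** K ** mat3 1 (b / a) (c / a) 0 1 0 0 0 1"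
      using M(1,3) by (simp add: K_def ds)
    then have "det K = 1" using M(2) by (simp add: det_mul carrier_SL)
    then have "K \<in> ?H"
      unfolding K_def by (intro block) (simp add: algebra_simps)
    then show ?thesis unfolding MK using mult N R by simp
  qed
  show "carrier SL \<subseteq> ?H"
  proof
    fix M :: "'a^3^3" assume SL: "M \<in> carrier SL"
    obtain a b c d e f g h i where M: "M = mat3 a b c d e f g h i" by (rule mat3_cases)
    \<comment> \<open>If the corner vanishes, some other entry of the first column does not, and
      adding its row to the first makes the corner nonzero.\<close>
    have step: "M \<in> ?H" if "a + r * d + s * g \<noteq> 0" for r s
    proof -
      define K where "K = mat3 1 r s 0 1 0 0 0 1 ** M"
      have "K \<in> carrier SL" using SL by (simp add: K_def carrier_SL det_mul)
      moreover have "K = mat3 (a + r * d + s * g) (b + r * e + s * h) (c + r * f + s * i) d e f g h i"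
        by (simp add: K_def M)
      ultimately have "K \<in> ?H" using corner that by blast
      moreover have "M = mat3 1 (- r) (- s) 0 1 0 0 0 1 ** K" by (simp add: K_def M)
      ultimately show ?thesis using mult R by metis
    qed
    have "a \<noteq> 0 \<or> d \<noteq> 0 \<or> g \<noteq> 0" using SL by (auto simp: M carrier_SL)
    then show "M \<in> ?H" using step[of 0 0] step[of 1 0] step[of 0 1] by (cases "a = 0") auto
  qed
qed

lemma generate_s123: "generate PSL {s1, s2, s3} = carrier PSL"
  using PSL_class.generate_img[of "{A, B, C}"] by (simp add: generate_ABC carrier_PSL s1_def s2_def s3_def)


section \<open>The intersection property\<close>

lemma generate_s3: "y \<in> generate PSL {s3} \<Longrightarrow> \<exists>n::nat. y = s3 [^]\<^bsub>PSL\<^esub> n"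
  and generate_s1: "y \<in> generate PSL {s1} \<Longrightarrow> \<exists>n::nat. y = s1 [^]\<^bsub>PSL\<^esub> n"
  using PSL.generate_pow_on_finite_carrier[OF finite_PSL, of s3]
    PSL.generate_pow_on_finite_carrier[OF finite_PSL, of s1] by auto

text \<open>Geometrically, the kernels of \<open>f1\<close> and \<open>f2\<close> meet in the point
  spanned by e1, so a matrix preserving this pair of lines fixes that point.\<close>

lemma dual_Stab_column:
  assumes M: "M \<in> carrier SL" and "dual M \<in> Stab"
  shows "M $ 2 $ 1 = 0" "M $ 3 $ 1 = 0"
proof -
  obtain a b c d e f g h i where Meq: "M = mat3 a b c d e f g h i" by (rule mat3_cases)
  from assms(2) have "d = 0 \<and> g = 0"
    using dual_eq[OF M] by (cases rule: Stab_cases) (auto simp: Meq P_def)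
  then show "M $ 2 $ 1 = 0" "M $ 3 $ 1 = 0" by (simp_all add: Meq)
qed

lemma s3_inter_s12: "generate PSL {s3} \<inter> generate PSL {s1, s2} \<subseteq> {\<one>\<^bsub>PSL\<^esub>}"
proof
  fix y assume y: "y \<in> generate PSL {s3} \<inter> generate PSL {s1, s2}"
  then obtain n :: nat where n: "y = s3 [^]\<^bsub>PSL\<^esub> n" using generate_s3 by blast
  then have "dual (C [^]\<^bsub>SL\<^esub> n) \<in> Stab" using y mem_s12_iff[OF C_power_SL] by (simp add: s3_power)
  from dual_Stab_column(1)[OF C_power_SL this] have "(1 + inverse x) * (x ^ n - 1) = 0"
    by (simp add: C_power)
  moreover have "1 + inverse x \<noteq> 0" using x_neq(6) by (simp add: field_simps)
  ultimately have "x ^ n = 1" by simp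
  then show "y \<in> {\<one>\<^bsub>PSL\<^esub>}" using n s3_power_eq_one_iff by simp
qed

text \<open>The dual of \<open>s3_inter_s12\<close>, as \<open>psl_dual\<close> exchanges the two
  pairs of subgroups.\<close>

lemma s1_inter_s23: "generate PSL {s1} \<inter> generate PSL {s2, s3} \<subseteq> {\<one>\<^bsub>PSL\<^esub>}"
proof
  fix y assume y: "y \<in> generate PSL {s1} \<inter> generate PSL {s2, s3}"
  then obtain n :: nat where n: "y = s1 [^]\<^bsub>PSL\<^esub> n" using generate_s1 by blast
  have yc: "y \<in> carrier PSL" by (simp add: n)
  have "s3 [^]\<^bsub>PSL\<^esub> n \<in> generate PSL {s3}"
    using PSL.generate_pow_on_finite_carrier[OF finite_PSL, of s3] by auto
  then have "psl_dual y \<in> generate PSL {s3}"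
    by (simp add: n psl_dual_s1_power PSL.generate_m_inv_closed)
  moreover have "psl_dual y \<in> generate PSL {s1, s2}"
  proof -
    obtain M where M: "M \<in> carrier SL" "y = PSL_class M" using yc by (rule PSL_cases)
    then have "M \<in> Stab" using y mem_s23_iff by simp
    then show ?thesis using M mem_s12_iff[of "dual M"] by (simp add: psl_dual_class dual_dual)
  qed
  ultimately have "psl_dual y = \<one>\<^bsub>PSL\<^esub>" using s3_inter_s12 by blast
  then show "y \<in> {\<one>\<^bsub>PSL\<^esub>}" using psl_dual_eq_one_iff[OF yc] by simp
qed

lemma diag_mem_generate_B:
  assumes "y \<noteq> 0"
  shows "mat3 (inverse (y * y)) 0 0  0 y 0  0 0 y \<in> generate SL {B}"
proof -
  obtain n where "y = x ^ n" using ex_power[OF assms] by blast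
  then have "mat3 (inverse (y * y)) 0 0  0 y 0  0 0 y = B [^]\<^bsub>SL\<^esub> (2 * n)" by (simp only: B_power_even)
  then show ?thesis
    using SL.generate_pow_on_finite_carrier[OF finite_SL, of B] by auto
qed

text \<open>A matrix in both groups fixes the point spanned by e1 and preserves the pair of points
  spanned by e2 and e3, so it is monomial. Preserving the two lines as well ties \<open>c\<close> to
  \<open>e\<close>, which leaves only powers of \<open>B\<close>; the other combinations would force
  \<open>x * x = 1\<close>.\<close>

lemma s12_inter_s23: "generate PSL {s1, s2} \<inter> generate PSL {s2, s3} \<subseteq> generate PSL {s2}"
proof
  fix z assume z: "z \<in> generate PSL {s1, s2} \<inter> generate PSL {s2, s3}"
  then have "z \<in> carrier PSL" using PSL.generate_incl[of "{s1, s2}"] by auto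
  then obtain M where M: "M \<in> carrier SL" "z = PSL_class M" by (rule PSL_cases)
  then have dM: "dual M \<in> Stab" and MSt: "M \<in> Stab" using z mem_s12_iff mem_s23_iff by auto
  have gB: "subgroup (generate SL {B}) SL" by (rule SL.generate_is_subgroup) simp
  note col = dual_Stab_column[OF M(1) dM]
  have xx: "e = x * c \<Longrightarrow> c = x * e \<Longrightarrow> c = 0" for c e :: 'a
  proof -
    assume "e = x * c" "c = x * e"
    then have "c * (x * x - 1) = 0" by (simp add: algebra_simps)
    then show "c = 0" by simp
  qed
  from MSt have "M \<in> generate SL {B}"
  proof (cases rule: Stab_cases)
    case (L a b c d e)
    with col have bd: "b = 0" "d = 0" by auto
    have nz: "c \<noteq> 0" "e \<noteq> 0" using L by auto
    from dM have "c = e"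
    proof (cases rule: Stab_cases)
      case (L a' b' c' d' e')
      then have "c' * c = 1" "c' * e = 1"
        using dual_eq[OF M(1)] \<open>M = L a b c d e\<close> bd by (auto simp: P_def)
      then show ?thesis by (metis mult.assoc mult.commute mult_1_left)
    next
      case (W a' b' c' d' e')
      then have "c' * c = 1" "c' * x * e = 1" "e' * c = 1" "e' * e = x"
        using dual_eq[OF M(1)] \<open>M = L a b c d e\<close> bd by (auto simp: P_def mult.assoc)
      then have "c = x * e" "e = x * c"
        by (metis mult.assoc mult.commute mult_1_left, metis mult.assoc mult.commute mult_1_left)
      then show ?thesis using xx nz by blast
    qed
    moreover have "a = inverse (c * c)"
      using L(2) \<open>c = e\<close> by (metis inverse_unique mult.assoc mult.commute)
    ultimately show ?thesis using diag_mem_generate_B[OF nz(1)] L bd by simp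
  next
    case (W a b c d e)
    with col have bd: "b = 0" "d = 0" by auto
    have nz: "c \<noteq> 0" "e \<noteq> 0" using W by auto
    from dM have ec: "e = x * c"
    proof (cases rule: Stab_cases)
      case (L a' b' c' d' e')
      then have "c' * c = 1" "c' * e = 1" "e' * x * c = 1" "e' * e = x"
        using dual_eq[OF M(1)] \<open>M = W a b c d e\<close> bd by (auto simp: P_def mult.assoc)
      then have "c = e" "e = x * (x * c)"
        by (metis mult.assoc mult.commute mult_1_left, metis mult.assoc mult.commute mult_1_left)
      then have "x * x * c = 1 * c" by (simp add: mult.assoc)
      then have "x * x = 1" using nz(1) mult_right_cancel by blast
      then show ?thesis by simp
    next
      case (W a' b' c' d' e')
      then have "e' * c = 1" "e' * e = x"
        using dual_eq[OF M(1)] \<open>M = W a b c d e\<close> bd by (auto simp: P_def)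
      then show ?thesis by (metis mult.assoc mult.commute mult_1_left)
    qed
    have "a * (x * (c * c)) = - 1" using W(2) ec by (simp add: algebra_simps)
    then have "a = inverse (c * c) * - inverse x" using nz by (simp add: field_simps)
    then have "M = mat3 (inverse (c * c)) 0 0  0 c 0  0 0 c ** B"
      using W bd ec by (simp add: B_def mult.commute)
    moreover have "B \<in> generate SL {B}" by (rule generate.incl) simp
    ultimately show ?thesis
      using diag_mem_generate_B[OF nz(1)] subgroup.m_closed[OF gB] by fastforce
  qed
  then show "z \<in> generate PSL {s2}"
    using M(2) PSL_class.generate_img[of "{B}"] by (auto simp: s2_def)
qed

text \<open>The row vector \<open>f2\<close> is fixed by right multiplication with \<open>A\<close>,
  hence with all its powers. The last two equations are the second and third coordinates of this
  fact.\<close>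

lemma A_power:
  fixes n :: nat
  shows "(A [^]\<^bsub>SL\<^esub> n) $ 3 $ 1 = 0" "(A [^]\<^bsub>SL\<^esub> n) $ 2 $ 2 - (A [^]\<^bsub>SL\<^esub> n) $ 3 $ 2 / x = 1"
    "(A [^]\<^bsub>SL\<^esub> n) $ 2 $ 3 - (A [^]\<^bsub>SL\<^esub> n) $ 3 $ 3 / x = - inverse x"
proof -
  have "\<exists>a b c e f h i. A [^]\<^bsub>SL\<^esub> n = mat3 a b c 0 e f 0 h i \<and> e - h / x = 1 \<and> f - i / x = - inverse x"
  proof (induction n)
    case 0
    have "A [^]\<^bsub>SL\<^esub> (0::nat) = mat3 1 0 0 0 1 0 0 0 1" by (simp add: mat_eq_mat3)
    then show ?case by (intro exI conjI, assumption) (simp_all add: inverse_eq_divide)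
  next
    case (Suc n)
    then obtain a b c e f h i where A: "A [^]\<^bsub>SL\<^esub> n = mat3 a b c 0 e f 0 h i"
      and e: "e = 1 + h / x" and f: "f = i / x - inverse x" by (auto simp: algebra_simps)
    have "A [^]\<^bsub>SL\<^esub> Suc n = mat3 (a * x) (a + b * (1 + inverse x) + c) (- b * inverse x)
        0 (e * (1 + inverse x) + f) (- e * inverse x) 0 (h * (1 + inverse x) + i) (- h * inverse x)"
      by (simp add: A) (simp add: A_def)
    then show ?case
      by (intro exI conjI, assumption) (simp_all add: e f field_simps)
  qed
  then show "(A [^]\<^bsub>SL\<^esub> n) $ 3 $ 1 = 0" "(A [^]\<^bsub>SL\<^esub> n) $ 2 $ 2 - (A [^]\<^bsub>SL\<^esub> n) $ 3 $ 2 / x = 1"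
    "(A [^]\<^bsub>SL\<^esub> n) $ 2 $ 3 - (A [^]\<^bsub>SL\<^esub> n) $ 3 $ 3 / x = - inverse x"
    by auto
qed

text \<open>Comparing a power of \<open>A\<close> with the product through \<open>A_power\<close>:
  the second column gives the scalar -1, the third gives \<open>x ^ m = 1\<close>, and then the
  (3,1) entry would make \<open>x\<close> its own inverse.\<close>

lemma s1_power_neq:
  assumes "y \<in> generate PSL {s1}" "z \<in> generate PSL {s3}"
  shows "y \<noteq> (s1 \<otimes>\<^bsub>PSL\<^esub> (s2 \<otimes>\<^bsub>PSL\<^esub> s3)) \<otimes>\<^bsub>PSL\<^esub> z"
proof
  assume eq: "y = (s1 \<otimes>\<^bsub>PSL\<^esub> (s2 \<otimes>\<^bsub>PSL\<^esub> s3)) \<otimes>\<^bsub>PSL\<^esub> z"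
  obtain n m :: nat where n: "y = s1 [^]\<^bsub>PSL\<^esub> n" and m: "z = s3 [^]\<^bsub>PSL\<^esub> m"
    using assms generate_s1 generate_s3 by blast
  have An: "A [^]\<^bsub>SL\<^esub> n \<in> carrier SL" using SL.nat_pow_closed[of A n] by simp
  have "y = PSL_class (A [^]\<^bsub>SL\<^esub> n)" using PSL_class.hom_nat_pow[of A n] by (simp add: n s1_def)
  then have "PSL_class (A [^]\<^bsub>SL\<^esub> n) = PSL_class (A ** (B ** C) ** C [^]\<^bsub>SL\<^esub> m)"
    using eq by (simp add: m s_prod(3) s3_power PSL_class_mult prod_SL C_power_SL)
  moreover have "A ** (B ** C) ** C [^]\<^bsub>SL\<^esub> m \<in> carrier SL"
    using SL.m_closed[OF prod_SL(3) C_power_SL] by simp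
  ultimately obtain k where k: "A [^]\<^bsub>SL\<^esub> n = mat k ** (A ** (B ** C) ** C [^]\<^bsub>SL\<^esub> m)"
    using PSL_class_eq_iff[OF An] by blast
  define r where "r = x ^ m"
  have r: "r \<noteq> 0" by (simp add: r_def)
  have *: "A [^]\<^bsub>SL\<^esub> n = mat3 k 0 0 0 k 0 0 0 k ** (mat3 (- inverse x) 0 (inverse x)
    (1 - inverse x * inverse x) (- 1) ((1 + inverse x) * inverse x)  (x - inverse x) 0 (inverse x) **
    mat3 r 0 0  ((1 + inverse x) * (r - 1)) 1 0  (r - inverse r) 0 (inverse r))"
    unfolding k C_power ABC_eq mat_eq_mat3 r_def ..
  have 1: "k = - 1" using A_power(2)[of n] unfolding * by (simp add: minus_equation_iff[of k])
  have "k * ((1 + inverse x) * inverse x * inverse r) - k * (inverse x * inverse r) / x = - inverse x"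
    using A_power(3)[of n] unfolding * by simp
  moreover have "k * ((1 + inverse x) * inverse x * inverse r) - k * (inverse x * inverse r) / x =
      k * (inverse x * inverse r)"
    by (simp add: divide_inverse algebra_simps)
  ultimately have "inverse r = 1" by (simp add: 1)
  then have r1: "r = 1" by simp
  have "k * ((x - inverse x) * r + inverse x * (r - inverse r)) = 0"
    using A_power(1)[of n] unfolding * by simp
  then have "x = inverse x" by (simp add: 1 r1)
  then show False by simp
qed

lemma intersection: "intersection_property PSL 4 [s1, s2, s3]"
  using involutions s_nontrivial s3_inter_s12 s1_inter_s23 s12_inter_s23 s1_power_neq
  by (intro PSL.intersection_property_rank4 finite_PSL s_carrier)


section \<open>Chirality\<close>

lemma C_inv: "inv\<^bsub>SL\<^esub> C = L (inverse x) (inverse x * inverse x - 1) 1 (inverse x - x) x"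
  unfolding C_def by (subst L_inv; simp add: field_simps)

text \<open>Modulo elations the matrices in \<open>Stab\<close> are monomial and those of type
  \<open>L\<close> diagonal. A commutator with the inverse of \<open>C\<close> is thus of type
  \<open>L\<close>, and it is an elation when \<open>M\<close> itself is of type
  \<open>L\<close>.\<close>

lemma commutator_C:
  assumes M: "M \<in> Stab"
  defines "K \<equiv> M ** inv\<^bsub>SL\<^esub> C ** inv\<^bsub>SL\<^esub> M ** C"
  shows "\<exists>a b c d e. K = L a b c d e" and "M = L a b c d e \<Longrightarrow> \<exists>b d. K = L 1 b 1 d 1"
proof -
  have *: "\<exists>b d. K = L 1 b 1 d 1" if "M = L a b c d e" for a b c d e
  proof -
    have ace: "a * c * e = 1" using M that by (simp add: L_Stab)
    then have "a \<noteq> 0" "c \<noteq> 0" "e \<noteq> 0" by auto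
    then have "a * inverse x * inverse a * x = 1" "e * x * inverse e * inverse x = 1"
      by (simp_all add: field_simps)
    with \<open>c \<noteq> 0\<close> show ?thesis
      unfolding K_def that C_inv L_inv[OF ace] unfolding C_def by simp
  qed
  then show "M = L a b c d e \<Longrightarrow> \<exists>b d. K = L 1 b 1 d 1" by blast
  from M show "\<exists>a b c d e. K = L a b c d e"
  proof (cases rule: Stab_cases)
    case L
    then show ?thesis using * by blast
  next
    case (W a b c d e)
    then show ?thesis unfolding K_def W(1) C_inv W_inv[OF W(2)] unfolding C_def by simp
  qed
qed

text \<open>If \<open>f 1\<close> is nonzero then \<open>f y = f 1 / y\<close>, and additivity at
  \<open>1 + x\<close> gives \<open>x * x + x + 1 = 0\<close>, so \<open>x\<close> would have cube
  1.\<close>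

lemma additive_inverse_twist_zero:
  fixes f :: "'a \<Rightarrow> 'a"
  assumes add: "\<And>y z. f (y + z) = f y + f z" and scale: "\<And>y. f (x * y) = f y / x"
  shows "f 1 = 0"
proof (rule ccontr)
  assume f1: "f 1 \<noteq> 0"
  have f: "f y = f 1 / y" if "y \<noteq> 0" for y
    using that by (induction rule: nonzero_induct) (simp_all only: scale, simp_all add: field_simps)
  have "f 1 / (1 + x) = f 1 + f 1 / x"
    using add[of 1 x] f[of "1 + x"] f[of x] by simp
  then have "f 1 * x = f 1 * ((1 + x) * (1 + x))" by (simp add: field_simps)
  then have "x = (1 + x) * (1 + x)" using f1 by simp
  then have "x * x + x + 1 = 0" by (simp add: algebra_simps)
  then have "(x - 1) * (x * x + x + 1) = 0" by simp
  then have "x * (x * x) = 1" by (simp add: algebra_simps)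
  then show False by simp
qed

text \<open>Here \<open>f y = f 1 / (y * y)\<close>. Additivity at 1 and -1 forces characteristic
  two, and at \<open>1 + x\<close> it then makes the square of \<open>x * x + x + 1\<close>
  vanish.\<close>

lemma additive_inverse_square_twist_zero:
  fixes f :: "'a \<Rightarrow> 'a"
  assumes add: "\<And>y z. f (y + z) = f y + f z" and scale: "\<And>y. f (x * y) = f y / (x * x)"
  shows "f 1 = 0"
proof (rule ccontr)
  assume f1: "f 1 \<noteq> 0"
  have f: "f y = f 1 / (y * y)" if "y \<noteq> 0" for y
    using that by (induction rule: nonzero_induct) (simp_all only: scale, simp_all add: field_simps)
  have "f 0 = 0" using add[of 0 0] by (metis add.right_neutral add_left_cancel)
  then have "f 1 + f 1 = 0" using add[of 1 "- 1"] f[of "- 1"] by simp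
  then have "f 1 * (1 + 1) = 0" by (simp add: algebra_simps)
  then have two: "(1 + 1 :: 'a) = 0" using f1 by simp
  then have two': "y + y = 0" for y :: 'a by (metis distrib_left mult_1_right mult_zero_right)
  have "f 1 / ((1 + x) * (1 + x)) = f 1 + f 1 / (x * x)"
    using add[of 1 x] f[of "1 + x"] f[of x] by simp
  moreover obtain z where z: "z = 1 + x" "z \<noteq> 0" by simp
  ultimately have "f 1 * (x * x) = f 1 * ((x * x + 1) * (z * z))"
    unfolding z(1)[symmetric] by (simp add: field_simps)
  then have e: "x * x = (x * x + 1) * ((1 + x) * (1 + x))" using f1 z(1) by simp
  have "(x * x + x + 1) * (x * x + x + 1) = (x * x + 1) * ((1 + x) * (1 + x)) - x * x + (x * x + x * x)"
    by (simp add: algebra_simps)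
  then have "(x * x + x + 1) * (x * x + x + 1) = 0" using e two' by simp
  then have "(x - 1) * (x * x + x + 1) = 0" by simp
  then have "x * (x * x) = 1" by (simp add: algebra_simps)
  then show False by simp
qed

lemma no_inverting_hom:
  assumes hom: "\<psi> \<in> hom PSL PSL" and inj: "inj_on \<psi> (carrier PSL)"
    and p3: "\<psi> s3 = inv\<^bsub>PSL\<^esub> s3" and p23: "\<psi> (s2 \<otimes>\<^bsub>PSL\<^esub> s3) = s2 \<otimes>\<^bsub>PSL\<^esub> s3"
  shows False
proof -
  interpret psi: group_hom "PSL :: ('a^3^3) set monoid" PSL \<psi>
    by (intro group_hom.intro group_PSL group_hom_axioms.intro hom)
  let ?Q = "generate PSL {s2, s3}"
  have Q: "subgroup ?Q PSL" by (rule PSL.generate_is_subgroup) simp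
  have s3Q: "s3 \<in> ?Q" and s2Q: "s2 \<in> ?Q" by (auto intro: generate.incl)
  have psiQ: "\<psi> y \<in> ?Q" if "y \<in> ?Q" for y
  proof -
    \<comment> \<open>Writing \<open>s2\<close> through the two elements with known images shows
      that \<open>\<psi>\<close> maps \<open>?Q\<close> into itself.\<close>
    have "s2 = s2 \<otimes>\<^bsub>PSL\<^esub> s3 \<otimes>\<^bsub>PSL\<^esub> inv\<^bsub>PSL\<^esub> s3" by (simp add: PSL.m_assoc)
    then have "\<psi> s2 = s2 \<otimes>\<^bsub>PSL\<^esub> s3 \<otimes>\<^bsub>PSL\<^esub> s3"
      using p3 p23 psi.hom_mult[of "s2 \<otimes>\<^bsub>PSL\<^esub> s3" "inv\<^bsub>PSL\<^esub> s3"] psi.hom_inv[of s3]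
      by (metis PSL.inv_closed PSL.inv_inv PSL.m_closed s_carrier(2,3))
    then have "\<psi> ` {s2, s3} \<subseteq> ?Q"
      using subgroup.m_closed[OF Q] subgroup.m_inv_closed[OF Q] s2Q s3Q p3 by simp
    then have "generate PSL (\<psi> ` {s2, s3}) \<subseteq> ?Q" using Q by (rule PSL.generate_subgroup_incl)
    then show ?thesis using psi.generate_img[of "{s2, s3}"] that by auto
  qed
  define N where "N = (\<lambda>b d. L 1 b 1 d 1)"
  have NSL: "N b d \<in> carrier SL" for b d by (simp add: N_def carrier_SL)
  have N_eq: "b = b' \<and> d = d'" if "PSL_class (N b d) = PSL_class (N b' d')" for b d b' d'
    using that PSL_class_eq_iff[OF NSL NSL] by (auto simp: N_def mat_eq_mat3)
  define U where "U b = PSL_class (N b 0)" for b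
  have Uc [simp]: "U b \<in> carrier PSL" for b by (simp add: U_def NSL)
  have UQ: "U b \<in> ?Q" for b by (simp add: U_def mem_s23_iff NSL) (simp add: N_def L_Stab)
  have commutator: "\<psi> (U (b * (1 - inverse x))) =
      \<psi> (U b) \<otimes>\<^bsub>PSL\<^esub> inv\<^bsub>PSL\<^esub> s3 \<otimes>\<^bsub>PSL\<^esub> inv\<^bsub>PSL\<^esub> (\<psi> (U b)) \<otimes>\<^bsub>PSL\<^esub> s3" for b
  proof -
    \<comment> \<open>The elations \<open>N b 0\<close> form an eigenspace of conjugation by
      \<open>C\<close>, so their commutators with \<open>C\<close> stay in it. As
      \<open>\<psi>\<close> inverts \<open>s3\<close>, the images are commutators with the inverse
      of \<open>s3\<close>.\<close>
    have "N (b * (1 - inverse x)) 0 ** C ** N b 0 = N b 0 ** C"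
      by (simp add: N_def C_def) (simp add: field_simps)
    then have "U (b * (1 - inverse x)) \<otimes>\<^bsub>PSL\<^esub> s3 \<otimes>\<^bsub>PSL\<^esub> U b = U b \<otimes>\<^bsub>PSL\<^esub> s3"
      using SL.m_closed[OF NSL ABC_SL(3)] by (simp add: U_def s3_def PSL_class_mult NSL)
    then have "\<psi> (U (b * (1 - inverse x))) \<otimes>\<^bsub>PSL\<^esub> \<psi> s3 \<otimes>\<^bsub>PSL\<^esub> \<psi> (U b) = \<psi> (U b) \<otimes>\<^bsub>PSL\<^esub> \<psi> s3"
      by (metis PSL.m_closed Uc psi.hom_mult s_carrier(3))
    moreover define y where "y = \<psi> (U b)"
    moreover define z where "z = \<psi> (U (b * (1 - inverse x)))"
    ultimately have "z \<otimes>\<^bsub>PSL\<^esub> inv\<^bsub>PSL\<^esub> s3 \<otimes>\<^bsub>PSL\<^esub> y = y \<otimes>\<^bsub>PSL\<^esub> inv\<^bsub>PSL\<^esub> s3" by (simp add: p3)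
    moreover have c: "y \<in> carrier PSL" "z \<in> carrier PSL" by (simp_all add: y_def z_def)
    ultimately have "z = y \<otimes>\<^bsub>PSL\<^esub> inv\<^bsub>PSL\<^esub> s3 \<otimes>\<^bsub>PSL\<^esub> inv\<^bsub>PSL\<^esub> y \<otimes>\<^bsub>PSL\<^esub> inv\<^bsub>PSL\<^esub> (inv\<^bsub>PSL\<^esub> s3)"
      by (intro PSL.commutator_eqI) simp_all
    then have "z = y \<otimes>\<^bsub>PSL\<^esub> inv\<^bsub>PSL\<^esub> s3 \<otimes>\<^bsub>PSL\<^esub> inv\<^bsub>PSL\<^esub> y \<otimes>\<^bsub>PSL\<^esub> s3" by simp
    then show ?thesis by (simp add: y_def z_def)
  qed
  have class_comm: "PSL_class M \<otimes>\<^bsub>PSL\<^esub> inv\<^bsub>PSL\<^esub> s3 \<otimes>\<^bsub>PSL\<^esub> inv\<^bsub>PSL\<^esub> (PSL_class M) \<otimes>\<^bsub>PSL\<^esub> s3 =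
      PSL_class (M ** inv\<^bsub>SL\<^esub> C ** inv\<^bsub>SL\<^esub> M ** C)" if M: "M \<in> carrier SL" for M
  proof -
    have "M ** inv\<^bsub>SL\<^esub> C \<in> carrier SL" "M ** inv\<^bsub>SL\<^esub> C ** inv\<^bsub>SL\<^esub> M \<in> carrier SL"
      using M SL.m_closed[of M "inv\<^bsub>SL\<^esub> C"] SL.m_closed[of "M ** inv\<^bsub>SL\<^esub> C" "inv\<^bsub>SL\<^esub> M"] by simp_all
    then show ?thesis
      using M by (simp add: s3_def PSL_class_mult flip: PSL_class.hom_inv)
  qed
  \<comment> \<open>Since \<open>x\<close> is not 1, each \<open>U b\<close> is such a commutator.
    Using this twice places \<open>\<psi> (U b)\<close> first in type \<open>L\<close> and then
    among the elations.\<close>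
  have surj: "\<exists>b'. b = b' * (1 - inverse x)" for b
    by (rule exI[of _ "b / (1 - inverse x)"]) (simp add: inverse_eq_1_iff)
  have psiU1: "\<exists>M\<in>Stab. \<psi> (U b) = PSL_class M \<and> (\<exists>a b c d e. M = L a b c d e)" for b
  proof -
    obtain b' where b': "b = b' * (1 - inverse x)" using surj by blast
    obtain M where M: "M \<in> carrier SL" "\<psi> (U b') = PSL_class M"
      using psi.hom_closed[OF Uc] by (rule PSL_cases)
    then have MSt: "M \<in> Stab" using psiQ[OF UQ[of b']] mem_s23_iff by simp
    let ?K = "M ** inv\<^bsub>SL\<^esub> C ** inv\<^bsub>SL\<^esub> M ** C"
    have "\<psi> (U b) = PSL_class ?K" using commutator[of b'] class_comm[OF M(1)] by (simp add: b' M(2))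
    moreover have "?K \<in> Stab"
      using MSt BC_Stab subgroup.m_closed[OF subgroup_Stab] subgroup.m_inv_closed[OF subgroup_Stab] by simp
    ultimately show ?thesis using commutator_C(1)[OF MSt] by blast
  qed
  have "\<exists>\<beta> \<gamma>. \<psi> (U b) = PSL_class (N \<beta> \<gamma>)" for b
  proof -
    obtain b' where b': "b = b' * (1 - inverse x)" using surj by blast
    obtain M a c d e f where M: "M \<in> Stab" "\<psi> (U b') = PSL_class M" "M = L a c d e f"
      using psiU1[of b'] by blast
    have "\<psi> (U (b' * (1 - inverse x))) = PSL_class (M ** inv\<^bsub>SL\<^esub> C ** inv\<^bsub>SL\<^esub> M ** C)"
      using commutator[of b'] class_comm[OF Stab_SL[OF M(1)]] by (simp add: M(2))
    moreover obtain \<beta> \<gamma> where "M ** inv\<^bsub>SL\<^esub> C ** inv\<^bsub>SL\<^esub> M ** C = N \<beta> \<gamma>"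
      using commutator_C(2)[OF M(1,3)] unfolding N_def by blast
    ultimately have "\<psi> (U b) = PSL_class (N \<beta> \<gamma>)" by (simp only: b')
    then show ?thesis by blast
  qed
  then obtain \<beta> \<gamma> where psiU: "\<And>b. \<psi> (U b) = PSL_class (N (\<beta> b) (\<gamma> b))" by metis
  have add: "\<beta> (y + z) = \<beta> y + \<beta> z \<and> \<gamma> (y + z) = \<gamma> y + \<gamma> z" for y z
  proof (rule N_eq)
    have NN: "N b d ** N b' d' = N (b + b') (d + d')" for b d b' d' by (simp add: N_def add.commute)
    have "U (y + z) = U y \<otimes>\<^bsub>PSL\<^esub> U z" by (simp add: U_def PSL_class_mult NSL NN)
    then have "\<psi> (U (y + z)) = \<psi> (U y) \<otimes>\<^bsub>PSL\<^esub> \<psi> (U z)" by simp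
    then show "PSL_class (N (\<beta> (y + z)) (\<gamma> (y + z))) = PSL_class (N (\<beta> y + \<beta> z) (\<gamma> y + \<gamma> z))"
      by (simp add: psiU PSL_class_mult NSL NN)
  qed
  have scale: "\<beta> y = x * \<beta> (x * y) \<and> \<gamma> y = x * x * \<gamma> (x * y)" for y
  proof -
    \<comment> \<open>Under \<open>\<psi>\<close> the relation for \<open>C\<close> becomes one for
      its inverse, whose eigenvalues on the two coordinates differ. This yields the two incompatible
      scaling rules for \<open>\<beta>\<close> and \<open>\<gamma>\<close>.\<close>
    have "C ** N (x * y) 0 = N y 0 ** C" by (simp add: N_def C_def field_simps)
    then have "s3 \<otimes>\<^bsub>PSL\<^esub> U (x * y) = U y \<otimes>\<^bsub>PSL\<^esub> s3" by (simp add: s3_def U_def PSL_class_mult NSL)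
    then have "inv\<^bsub>PSL\<^esub> s3 \<otimes>\<^bsub>PSL\<^esub> \<psi> (U (x * y)) = \<psi> (U y) \<otimes>\<^bsub>PSL\<^esub> inv\<^bsub>PSL\<^esub> s3"
      by (metis Uc p3 psi.hom_mult s_carrier(3))
    then have "PSL_class (inv\<^bsub>SL\<^esub> C ** N (\<beta> (x * y)) (\<gamma> (x * y))) = PSL_class (N (\<beta> y) (\<gamma> y) ** inv\<^bsub>SL\<^esub> C)"
      by (simp add: psiU s3_def PSL_class_mult NSL flip: PSL_class.hom_inv)
    moreover have "inv\<^bsub>SL\<^esub> C ** N b d \<in> carrier SL" "N b d ** inv\<^bsub>SL\<^esub> C \<in> carrier SL" for b d
      using SL.m_closed[of "inv\<^bsub>SL\<^esub> C" "N b d"] SL.m_closed[of "N b d" "inv\<^bsub>SL\<^esub> C"] NSL by simp_all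
    ultimately obtain k where "inv\<^bsub>SL\<^esub> C ** N (\<beta> (x * y)) (\<gamma> (x * y)) = mat k ** (N (\<beta> y) (\<gamma> y) ** inv\<^bsub>SL\<^esub> C)"
      using PSL_class_eq_iff by blast
    then show ?thesis
      by (simp add: C_inv N_def mat_eq_mat3) (auto simp: field_simps)
  qed
  have "\<beta> (x * y) = \<beta> y / x" "\<gamma> (x * y) = \<gamma> y / (x * x)" for y
    using scale[of y] by (simp_all add: nonzero_eq_divide_eq mult_ac)
  then have "\<beta> 1 = 0" "\<gamma> 1 = 0"
    using add by (blast intro: additive_inverse_twist_zero additive_inverse_square_twist_zero)+
  then have "\<psi> (U 1) = PSL_class (mat 1)" by (simp add: psiU N_def mat_eq_mat3)
  then have "\<psi> (U 1) = \<psi> \<one>\<^bsub>PSL\<^esub>" using PSL_class.hom_one by simp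
  then have "U 1 = \<one>\<^bsub>PSL\<^esub>" by (rule inj_onD[OF inj _ Uc PSL.one_closed])
  then show False using PSL_class_eq_one_iff[OF NSL] by (simp add: U_def N_def mat_eq_mat3)
qed

text \<open>Conjugating the forbidden automorphism by \<open>psl_dual\<close> moves its conditions
  from \<open>s1\<close> and \<open>s1 s2\<close> to \<open>s3\<close> and \<open>s2 s3\<close>,
  where the explicit stabiliser of two points can be used.\<close>

lemma chirality: "chirality_property PSL 4 [s1, s2, s3]"
  unfolding chirality_property_def
proof safe
  fix \<phi> assume iso: "\<phi> \<in> iso PSL PSL"
    and p1: "\<phi> (tau PSL [s1, s2, s3] 1 1) = inv\<^bsub>PSL\<^esub> (tau PSL [s1, s2, s3] 1 1)"
    and pt: "\<forall>i\<in>{2..4 - 1}. \<phi> (tau PSL [s1, s2, s3] 1 i) = tau PSL [s1, s2, s3] 1 i"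
  have f1: "\<phi> s1 = inv\<^bsub>PSL\<^esub> s1" using p1 by (simp add: PSL.tau_rank4)
  have f12: "\<phi> (s1 \<otimes>\<^bsub>PSL\<^esub> s2) = s1 \<otimes>\<^bsub>PSL\<^esub> s2"
    using pt[rule_format, of 2] by (simp add: PSL.tau_rank4)
  interpret phi: group_hom "PSL :: ('a^3^3) set monoid" PSL \<phi>
    using iso by (intro group_hom.intro group_PSL group_hom_axioms.intro) (simp add: iso_def)
  let ?psi = "psl_dual \<circ> \<phi> \<circ> psl_dual"
  have "?psi \<in> iso PSL PSL" 
    by (rule iso_set_trans[OF psl_dual_iso iso_set_trans[OF iso psl_dual_iso], unfolded comp_assoc[symmetric]])
  then have "?psi \<in> hom PSL PSL" "inj_on ?psi (carrier PSL)"
    by (auto simp: iso_def bij_betw_def)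
  moreover have "?psi s3 = inv\<^bsub>PSL\<^esub> s3" by (simp add: psl_dual_s f1)
  moreover have "?psi (s2 \<otimes>\<^bsub>PSL\<^esub> s3) = s2 \<otimes>\<^bsub>PSL\<^esub> s3"
  proof -
    have "psl_dual (s2 \<otimes>\<^bsub>PSL\<^esub> s3) = inv\<^bsub>PSL\<^esub> (s1 \<otimes>\<^bsub>PSL\<^esub> s2)" by (simp add: psl_dual_s PSL.inv_mult_group)
    moreover have "\<phi> \<dots> = inv\<^bsub>PSL\<^esub> (s1 \<otimes>\<^bsub>PSL\<^esub> s2)" using f12 by simp
    ultimately show ?thesis using psl_dual_psl_dual[of "s2 \<otimes>\<^bsub>PSL\<^esub> s3"] by simp
  qed
  ultimately show False by (rule no_inverting_hom)
qed

end

theorem theorem1p1: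
  fixes q :: nat and x :: "'a::{field,finite}"
    and \<sigma>\<^sub>1 \<sigma>\<^sub>2 \<sigma>\<^sub>3 :: "('a^3^3) set"
  assumes "primepow q" and "q \<ge> 5" and "CARD('a) = q"
    and "primitive_element x"
    and "\<sigma>\<^sub>1 = PSL_class (vector [vector [x, 1, 0],
                                vector [0, 1 + inverse x, - inverse x],
                                vector [0, 1, 0]])"
    and "\<sigma>\<^sub>2 = PSL_class (vector [vector [- inverse x, 0, 0],
                                vector [0, 0, 1],
                                vector [0, x, 0]])"
    and "\<sigma>\<^sub>3 = PSL_class (vector [vector [x, 0, 0],
                                vector [x - inverse x, 1, 0],
                                vector [x - inverse x, 0, inverse x]])"
  shows "gives_chiral_polytope PSL 4 [\<sigma>\<^sub>1, \<sigma>\<^sub>2, \<sigma>\<^sub>3] \<and>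
    (\<exists>l\<^sub>1 \<in> proj_lines. \<exists>l\<^sub>2 \<in> proj_lines. l\<^sub>1 \<noteq> l\<^sub>2 \<and>
       generate PSL {\<sigma>\<^sub>1, \<sigma>\<^sub>2} = PSL_setwise_stabiliser {l\<^sub>1, l\<^sub>2}) \<and>
    (\<exists>p\<^sub>1 \<in> proj_points. \<exists>p\<^sub>2 \<in> proj_points. p\<^sub>1 \<noteq> p\<^sub>2 \<and>
       generate PSL {\<sigma>\<^sub>2, \<sigma>\<^sub>3} = PSL_setwise_stabiliser {p\<^sub>1, p\<^sub>2}) \<and>
    self_dual_rank4 PSL \<sigma>\<^sub>1 \<sigma>\<^sub>2 \<sigma>\<^sub>3 \<and>
    schlaefli_type PSL [\<sigma>\<^sub>1, \<sigma>\<^sub>2, \<sigma>\<^sub>3] = [q - 1, 2 * (q - 1) div gcd 3 (q - 1), q - 1]"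
proof -
  interpret primitive_ge5 x
    using assms(2,3,4) by unfold_locales simp_all
  have s: "\<sigma>\<^sub>1 = s1" "\<sigma>\<^sub>2 = s2" "\<sigma>\<^sub>3 = s3"
    by (simp_all add: assms(5-7) s1_def s2_def s3_def A_def B_def C_def mat3_def)
  have "gives_chiral_polytope PSL 4 [s1, s2, s3]"
    using string intersection chirality generate_s123 group_PSL
    by (simp add: gives_chiral_polytope_def)
  moreover have "schlaefli_type PSL [s1, s2, s3] = [q - 1, 2 * (q - 1) div gcd 3 (q - 1), q - 1]"
    using ord_s1 ord_s2 ord_s3 assms(3) by (simp add: schlaefli_type_def)
  ultimately show ?thesis
    unfolding s using self_dual lines points generate_s12_stabiliser generate_s23_stabiliser by blast
qed

end
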